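(* Let $G$ be a doubly-connected graph of order $n\ge 5$ and let $\overline G$ be its complement. Then $4\le\lambda(G)+\lambda(\overline G)\le 2n-5$. Moreover, up to isomorphism: (i) $\lambda(G)+\lambda(\overline G)=4$ if and only if $G\in\{P_5,C_5,B,H\}$; (ii) $\lambda(G)+\lambda(\overline G)=2n-5$ if and only if $G$ is one of $K_2(r,s)$, $\overline K_2(r,s)$ (for some integers $r,s\ge 1$), $K^s_{1,r}$, $\overline K^s_{1,r}$ (for some integers $r,s$ with $2\le s\le r-1$).
   Context: Graphs are finite, simple and undirected. A graph $G$ is doubly-connected if both $G$ and its complement $\overline G$ are connected. For a graph $G=(V,E)$, $N(v)$ is the open neighborhood of $v$. A set $D\subseteq V$ is a locating-dominating set (LD-set) if $N(u)\cap D\neq\emptyset$ for every $u\in V\setminus D$ and $N(u)\cap D\ne N(v)\cap D$ for every two distinct vertices $u,v\in V\setminus D$. The location-domination number $\lambda(G)$ is the minimum cardinality of a locating-dominating set of $G$. $P_5$ and $C_5$ are the path and cycle on 5 vertices. $B$ is the bull graph: a triangle with one pendant vertex attached to each of two distinct vertices of the triangle. $H=\overline{P_5}$ is the house graph (a 5-cycle with one chord). For positive integers $r,s$, $K_2(r,s)$ is the double star obtained by joining by an edge the central vertices of the stars $K_{1,r}$ and $K_{1,s}$ (so it has $r+s+2$ vertices). For $2\le s\le r-1$, $K^s_{1,r}$ is the graph obtained from the star $K_{1,r}$ by adding a new vertex adjacent to exactly $s$ leaves of the star (so it has $r+2$ vertices). $\overline K_2(r,s)$ and $\overline K^s_{1,r}$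 denote the complements of $K_2(r,s)$ and $K^s_{1,r}$. *)

theory Defs
  imports "Graph_Theory.Graph_Theory"
begin

text \<open>
  A finite simple undirected graph is a \<open>pair_graph\<close>: a finite vertex set together with
  an irreflexive and symmetric set of arcs, each undirected edge being represented by its two
  orientations.
\<close>

definition nbhd :: "'a pair_pre_digraph \<Rightarrow> 'a \<Rightarrow> 'a set" where
  "nbhd G v = {w. (v, w) \<in> parcs G}"

definition complement :: "'a pair_pre_digraph \<Rightarrow> 'a pair_pre_digraph" where
  "complement G = \<lparr> pverts = pverts G,
     parcs = {(u, v). u \<in> pverts G \<and> v \<in> pverts G \<and> u \<noteq> v \<and> (u, v) \<notin> parcs G} \<rparr>"

definition doubly_connected :: "'a pair_pre_digraph \<Rightarrow> bool" where
  "doubly_connected G \<longleftrightarrow>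
     Digraph_Component.connected (with_proj G) \<and>
     Digraph_Component.connected (with_proj (complement G))"

abbreviation graph_iso :: "'a pair_pre_digraph \<Rightarrow> 'b pair_pre_digraph \<Rightarrow> bool" where
  "graph_iso G H \<equiv> digraph_iso (with_proj G) (with_proj H)"

definition LD_set :: "'a pair_pre_digraph \<Rightarrow> 'a set \<Rightarrow> bool" where
  "LD_set G D \<longleftrightarrow> D \<subseteq> pverts G \<and>
     (\<forall>u \<in> pverts G - D. nbhd G u \<inter> D \<noteq> {}) \<and>
     (\<forall>u \<in> pverts G - D. \<forall>v \<in> pverts G - D. u \<noteq> v \<longrightarrow> nbhd G u \<inter> D \<noteq> nbhd G v \<inter> D)"

text \<open>The vertex set itself is always an LD-set, so the minimum below exists.\<close>

definition LD_number :: "'a pair_pre_digraph \<Rightarrow> nat" where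
  "LD_number G = (LEAST k. \<exists>D. LD_set G D \<and> card D = k)"

definition ugraph :: "'a set \<Rightarrow> ('a \<times> 'a) set \<Rightarrow> 'a pair_pre_digraph" where
  "ugraph V E = \<lparr> pverts = V, parcs = E \<union> E\<inverse> \<rparr>"

definition path5 :: "nat pair_pre_digraph" where
  "path5 = ugraph {0..4} {(0,1), (1,2), (2,3), (3,4)}"

definition cycle5 :: "nat pair_pre_digraph" where
  "cycle5 = ugraph {0..4} {(0,1), (1,2), (2,3), (3,4), (4,0)}"

definition bull :: "nat pair_pre_digraph" where
  "bull = ugraph {0..4} {(0,1), (1,2), (2,0), (0,3), (1,4)}"

definition house :: "nat pair_pre_digraph" where
  "house = complement path5"

text \<open>
  The double star: the centres are \<open>0\<close>, with leaves \<open>2, \<dots>, r + 1\<close>, and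
  \<open>1\<close>, with leaves \<open>r + 2, \<dots>, r + s + 1\<close>.
\<close>

definition double_star :: "nat \<Rightarrow> nat \<Rightarrow> nat pair_pre_digraph" where
  "double_star r s = ugraph {0..r + s + 1}
     ({(0, 1)} \<union> {0} \<times> {2..r + 1} \<union> {1} \<times> {r + 2..r + s + 1})"

text \<open>
  The graph obtained from the star with centre \<open>0\<close> and leaves \<open>1, \<dots>, r\<close> by adding a
  vertex \<open>r + 1\<close> adjacent to the leaves \<open>1, \<dots>, s\<close> (for \<open>s \<le> r\<close>).
\<close>

definition extended_star :: "nat \<Rightarrow> nat \<Rightarrow> nat pair_pre_digraph" where
  "extended_star r s = ugraph {0..r + 1} ({0} \<times> {1..r} \<union> {r + 1} \<times> {1..s})"

lemma pair_graph_complement: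
  assumes "finite (pverts G)" "sym (parcs G)"
  shows "pair_graph (complement G)"
proof -
  have "parcs (complement G) \<subseteq> pverts G \<times> pverts G"
    by (auto simp: complement_def)
  then have "finite (parcs (complement G))"
    using assms(1) by (meson finite_SigmaI finite_subset)
  then show ?thesis
    using assms
    by unfold_locales (auto simp: complement_def symmetric_def sym_def)
qed

lemma pair_graph_ugraph:
  assumes "finite V" "E \<subseteq> V \<times> V" "irrefl E"
  shows "pair_graph (ugraph V E)"
proof -
  have "finite E"
    using assms by (meson finite_SigmaI finite_subset)
  then show ?thesis
    using assms
    by unfold_locales (auto simp: ugraph_def symmetric_def sym_def irrefl_def)
qed

lemma pair_graph_examples:
  "pair_graph path5" "pair_graph cycle5" "pair_graph bull"
  "pair_graph (double_star r s)"
  "s \<le> r \<Longrightarrow> pair_graph (extended_star r s)"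
  by (auto simp: path5_def cycle5_def bull_def double_star_def extended_star_def irrefl_def
      intro!: pair_graph_ugraph)

lemma pair_graph_house: "pair_graph house"
  unfolding house_def
  by (rule pair_graph_complement) (auto simp: path5_def ugraph_def sym_def)

lemma LD_set_pverts: "LD_set G (pverts G)"
  by (simp add: LD_set_def)

end

theory Submission
  imports Defs
begin

text \<open>
  If vertices outside some \<open>D\<close> have distinct nonempty traces on \<open>D\<close>, this persists when \<open>D\<close>
  is enlarged by all remaining vertices. So a graph with \<open>\<lambda> \<ge> n - 2\<close> has no three such vertices for
  any \<open>D\<close>, a local condition. In a doubly-connected graph it forces an induced path
  \<open>v - a - b - z\<close>, and around such a path every vertex is adjacent to exactly one of \<open>a\<close>, \<open>b\<close>,
  both sides are independent, and the edges between them are so restricted that the graph is a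
  double star or an extended star. Those have \<open>\<lambda> = n - 2\<close> while their complements have
  \<open>\<lambda> = n - 3\<close>; this gives the upper bound and its equality case. At the other end, an LD-set of
  size two leaves at most three further vertices, so the sum is 4 only for \<open>n = 5\<close>, where four
  undetermined adjacencies remain.
\<close>

section \<open>Adjacency, separating traces and cuts\<close>

context pair_graph begin

abbreviation adjacent (infix "\<sim>" 50) where "u \<sim> v \<equiv> (u, v) \<in> parcs G"

lemma adjacent_sym: "u \<sim> v \<longleftrightarrow> v \<sim> u"
  using pair_sym_arcs by (auto simp: symmetric_def dest: symD)

lemma adjacent_irrefl [simp]: "\<not> u \<sim> u"
  using pair_no_loops by fastforce

lemma adjacent_verts: "u \<sim> v \<Longrightarrow> u \<in> pverts G" "u \<sim> v \<Longrightarrow> v \<in> pverts G"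
  by (auto dest: in_arcsD1 in_arcsD2)

lemma LD_number_le: "LD_set G D \<Longrightarrow> LD_number G \<le> card D"
  unfolding LD_number_def by (rule Least_le) auto

lemma LD_number_attained: obtains D where "LD_set G D" "card D = LD_number G"
proof -
  have "\<exists>k D. LD_set G D \<and> card D = k" using LD_set_pverts by blast
  from LeastI_ex[OF this] show ?thesis using that by (auto simp: LD_number_def)
qed

text \<open>Only a small set of witnesses for the separation is needed: enlarging \<open>D\<close> to all
  vertices other than \<open>x\<close>, \<open>y\<close>, \<open>z\<close> keeps the traces nonempty and distinct.\<close>

lemma LD_number_three_traces:
  assumes D: "D \<subseteq> pverts G" "D \<inter> {x, y, z} = {}" and V: "{x, y, z} \<subseteq> pverts G"
    and ne: "\<exists>d\<in>D. x \<sim> d" "\<exists>d\<in>D. y \<sim> d" "\<exists>d\<in>D. z \<sim> d"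
    and neq: "\<exists>d\<in>D. (x \<sim> d) \<noteq> (y \<sim> d)" "\<exists>d\<in>D. (x \<sim> d) \<noteq> (z \<sim> d)"
      "\<exists>d\<in>D. (y \<sim> d) \<noteq> (z \<sim> d)"
  shows "LD_number G + 3 \<le> card (pverts G)"
proof -
  let ?D = "pverts G - {x, y, z}"
  have sub: "D \<subseteq> ?D" using D by auto
  have dist: "x \<noteq> y" "x \<noteq> z" "y \<noteq> z" using neq by metis+
  have "nbhd G u \<inter> ?D \<noteq> {}" if "u \<in> {x, y, z}" for u
  proof -
    have "\<exists>d\<in>D. u \<sim> d" using that ne by (elim insertE emptyE) simp_all
    then obtain d where "d \<in> D" "u \<sim> d" ..
    then show ?thesis using sub by (auto simp: nbhd_def)
  qed
  moreover have "nbhd G u \<inter> ?D \<noteq> nbhd G w \<inter> ?D" if "u \<in> {x, y, z}" "w \<in> {x, y, z}" "u \<noteq> w" for u w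
  proof -
    define sep where "sep u w \<longleftrightarrow> (\<exists>d\<in>D. (u \<sim> d) \<noteq> (w \<sim> d))" for u w
    have "sep x y" "sep x z" "sep y z" using neq by (simp_all add: sep_def)
    moreover have "sep w u" if "sep u w" for u w using that unfolding sep_def by metis
    ultimately have "sep u w" using \<open>u \<in> {x, y, z}\<close> \<open>w \<in> {x, y, z}\<close> \<open>u \<noteq> w\<close> by auto
    then obtain d where "d \<in> D" "(u \<sim> d) \<noteq> (w \<sim> d)" unfolding sep_def ..
    then have "d \<in> ?D" "(d \<in> nbhd G u) \<noteq> (d \<in> nbhd G w)" using sub by (auto simp: nbhd_def)
    then show ?thesis by blast
  qed
  moreover have "pverts G - ?D = {x, y, z}" using V by blast
  ultimately have "LD_set G ?D" unfolding LD_set_def by auto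
  then have "LD_number G \<le> card ?D" by (rule LD_number_le)
  moreover have "card ?D = card (pverts G) - 3"
    using V dist by (subst card_Diff_subset) auto
  \<comment> \<open>This keeps the natural-number subtraction \<open>card (pverts G) - 3\<close>
    from being truncated.\<close>
  moreover have "card {x, y, z} \<le> card (pverts G)"
    using V pair_finite_verts by (rule card_mono[rotated])
  ultimately show ?thesis using dist by auto
qed

text \<open>The traces of \<open>x\<close>, \<open>y\<close>, \<open>z\<close> on the detectors
  \<open>p\<close>, \<open>q\<close> are \<open>{p}\<close>, \<open>{q}\<close> and
  \<open>{p, q}\<close>. Of the disjointness conditions, only \<open>x \<noteq> q\<close> and
  \<open>y \<noteq> p\<close> do not already follow from an adjacency.\<close>

lemma LD_number_two_detectors:
  assumes "x \<sim> p" "\<not> x \<sim> q" "y \<sim> q" "\<not> y \<sim> p" "z \<sim> p" "z \<sim> q" "x \<noteq> q" "y \<noteq> p"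
  shows "LD_number G + 3 \<le> card (pverts G)"
proof (rule LD_number_three_traces[of "{p, q}" x y z])
  show "{p, q} \<subseteq> pverts G" "{x, y, z} \<subseteq> pverts G"
    using assms adjacent_verts[of x p] adjacent_verts[of y q] adjacent_verts[of z p] by simp_all
  show "{p, q} \<inter> {x, y, z} = {}" using assms by auto
qed (use assms in auto)

text \<open>Taking traces maps the vertices outside \<open>D\<close> injectively into the nonempty
  subsets of \<open>D\<close>; leaving out the empty set makes the inequality strict.\<close>

lemma LD_set_card_bound:
  assumes "LD_set G D"
  shows "card (pverts G) < card D + 2 ^ card D"
proof -
  have D: "D \<subseteq> pverts G" "finite D" using assms finite_subset[OF _ pair_finite_verts] by (auto simp: LD_set_def)
  have "inj_on (\<lambda>u. nbhd G u \<inter> D) (pverts G - D)"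
    using assms by (auto simp: LD_set_def inj_on_def)
  moreover have "(\<lambda>u. nbhd G u \<inter> D) ` (pverts G - D) \<subseteq> Pow D - {{}}"
    using assms by (auto simp: LD_set_def)
  ultimately have "card (pverts G - D) \<le> card (Pow D - {{}})"
    using D by (intro card_inj_on_le) auto
  also have "\<dots> < 2 ^ card D" using D by (simp add: card_Pow card_Diff_singleton)
  finally show ?thesis using D by (simp add: card_Diff_subset card_mono pair_finite_verts)
qed

lemma LD_number_ge_2:
  assumes "card (pverts G) \<ge> 5"
  shows "LD_number G \<ge> 2"
proof (rule ccontr)
  assume "\<not> ?thesis"
  obtain D where D: "LD_set G D" "card D = LD_number G" by (rule LD_number_attained)
  with \<open>\<not> ?thesis\<close> have "card D = 0 \<or> card D = 1" by auto
  then show False using LD_set_card_bound[OF D(1)] assms by auto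
qed

text \<open>The form in which connectivity is used throughout. A walk from inside \<open>X\<close>
  to the outside must cross the boundary; the induction along the walk says that it is still in
  \<open>X\<close> or that a crossing edge has been found.\<close>

lemma connected_cut:
  assumes "Digraph_Component.connected (with_proj G)"
    and X: "X \<subseteq> pverts G" "X \<noteq> {}" "X \<noteq> pverts G"
  obtains u w where "u \<in> X" "w \<in> pverts G - X" "u \<sim> w"
proof -
  obtain s t where s: "s \<in> X" and t: "t \<in> pverts G" "t \<notin> X" using X by blast
  \<comment> \<open>Connectivity of a digraph is strong connectivity of its symmetric closure, and a
    symmetric arc set is its own closure.\<close>
  have m: "parcs (mk_symmetric (with_proj G)) = parcs G"
    using adj_mk_symmetric_eq[OF pair_sym_arcs] by simp
  have "s \<rightarrow>\<^sup>*\<^bsub>mk_symmetric (with_proj G)\<^esub> t"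
    using assms(1) s t X unfolding connected_def strongly_connected_def by auto
  then have "(s, t) \<in> rtrancl_on (pverts G) (parcs G)"
    by (simp add: reachable_def m)
  then have "t \<in> X \<or> (\<exists>u w. u \<in> X \<and> w \<in> pverts G - X \<and> u \<sim> w)"
  proof (induction rule: rtrancl_on_induct)
    case base then show ?case using s by blast
  next
    case (step y w) then show ?case by blast
  qed
  then show ?thesis using t that by blast
qed

end

section \<open>Complements\<close>

lemma pverts_complement [simp]: "pverts (complement G) = pverts G"
  by (simp add: complement_def)

lemma parcs_complement:
  "(u, v) \<in> parcs (complement G) \<longleftrightarrow> u \<in> pverts G \<and> v \<in> pverts G \<and> u \<noteq> v \<and> (u, v) \<notin> parcs G"
  by (simp add: complement_def)

lemma pair_graph_complementI:
  assumes "pair_graph G" shows "pair_graph (complement G)"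
proof -
  interpret pair_graph G by fact
  show ?thesis
    using pair_finite_verts pair_sym_arcs by (intro pair_graph_complement) (auto simp: symmetric_def)
qed

lemma complement_complement:
  assumes "pair_graph G" shows "complement (complement G) = G"
proof -
  interpret pair_graph G by fact
  show ?thesis
    by (intro pair_pre_digraph.equality) (auto simp: complement_def dest: adjacent_verts)
qed

lemma doubly_connected_complement:
  "pair_graph G \<Longrightarrow> doubly_connected (complement G) \<longleftrightarrow> doubly_connected G"
  by (auto simp: doubly_connected_def complement_complement)

context pair_graph begin

lemma co_connected_cut:
  assumes "Digraph_Component.connected (with_proj (complement G))"
    and X: "X \<subseteq> pverts G" "X \<noteq> {}" "X \<noteq> pverts G"
  obtains u w where "u \<in> X" "w \<in> pverts G - X" "\<not> u \<sim> w"
proof -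
  interpret co: pair_graph "complement G" by (rule pair_graph_complementI) unfold_locales
  show ?thesis
    using co.connected_cut[OF assms(1)] X that by (metis parcs_complement pverts_complement)
qed

text \<open>In a set of vertices with distinct traces on \<open>D\<close> at most one vertex has the full trace
  \<open>D\<close>; adding it to \<open>D\<close> makes the set dominating in the complement as well.\<close>

lemma LD_number_complement_le: "LD_number (complement G) \<le> LD_number G + 1"
proof -
  interpret co: pair_graph "complement G" by (rule pair_graph_complementI) unfold_locales
  obtain D where D: "LD_set G D" "card D = LD_number G" by (rule LD_number_attained)
  have fin: "finite D" and sub: "D \<subseteq> pverts G"
    using D finite_subset[OF _ pair_finite_verts] by (auto simp: LD_set_def)
  \<comment> \<open>Outside \<open>D\<close>, complementing the graph complements the trace within
    \<open>D\<close>. Distinct traces therefore stay distinct, and only nonemptiness can be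
    lost.\<close>
  have tr: "nbhd (complement G) u \<inter> D = D - nbhd G u" if "u \<in> pverts G - D" for u
    using that sub by (auto simp: nbhd_def parcs_complement)
  have sep: "u = w" if "u \<in> pverts G - D" "w \<in> pverts G - D"
    "nbhd (complement G) u \<inter> D = nbhd (complement G) w \<inter> D" for u w
  proof -
    have "nbhd G u \<inter> D = nbhd G w \<inter> D" using that tr by blast
    then show ?thesis using that D(1) unfolding LD_set_def by blast
  qed
  define X where "X = {u \<in> pverts G - D. nbhd (complement G) u \<inter> D = {}}"
  have "finite X" unfolding X_def using pair_finite_verts by auto
  have "card X \<le> 1"
    using sep \<open>finite X\<close> unfolding X_def One_nat_def by (subst card_le_Suc0_iff_eq) auto
  have "LD_set (complement G) (D \<union> X)"
    unfolding LD_set_def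
  proof (intro conjI ballI impI)
    show "D \<union> X \<subseteq> pverts (complement G)" using sub by (auto simp: X_def)
  next
    fix u assume u: "u \<in> pverts (complement G) - (D \<union> X)"
    then show "nbhd (complement G) u \<inter> (D \<union> X) \<noteq> {}" by (auto simp: X_def)
    fix w assume w: "w \<in> pverts (complement G) - (D \<union> X)" "u \<noteq> w"
    show "nbhd (complement G) u \<inter> (D \<union> X) \<noteq> nbhd (complement G) w \<inter> (D \<union> X)"
    proof
      assume "nbhd (complement G) u \<inter> (D \<union> X) = nbhd (complement G) w \<inter> (D \<union> X)"
      then have "nbhd (complement G) u \<inter> D = nbhd (complement G) w \<inter> D" by blast
      then show False using sep u w by auto
    qed
  qed
  then have "LD_number (complement G) \<le> card (D \<union> X)" by (rule co.LD_number_le)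
  also have "\<dots> \<le> LD_number G + 1" using card_Un_le[of D X] D \<open>card X \<le> 1\<close> by simp
  finally show ?thesis .
qed

end

section \<open>Isomorphisms\<close>

text \<open>A digraph isomorphism carries separate maps for vertices, arcs, heads and tails. When
  arcs are pairs, compatibility with heads and tails forces the arc map to be
  \<open>map_prod f f\<close>, so the vertex map alone carries the information.\<close>

lemma graph_iso_iff:
  assumes "pair_graph G"
  shows "graph_iso G H \<longleftrightarrow>
    (\<exists>f. inj_on f (pverts G) \<and> pverts H = f ` pverts G \<and> parcs H = map_prod f f ` parcs G)"
    (is "?L \<longleftrightarrow> ?R")
proof
  interpret pair_graph G by fact
  assume ?L
  then obtain h where h: "pre_digraph.digraph_isomorphism (with_proj G) h"
    "with_proj H = app_iso h (with_proj G)"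
    by (auto simp: digraph_iso_def)
  have "pverts H = iso_verts h ` pverts G" "parcs H = iso_arcs h ` parcs G"
    "iso_tail h = fst" "iso_head h = snd"
    using h(2) by (auto simp: with_proj_def app_iso_def)
  moreover have "iso_arcs h e = map_prod (iso_verts h) (iso_verts h) e" if "e \<in> parcs G" for e
    using that h(1) calculation(3,4)
    by (cases e, cases "iso_arcs h e") (force simp: pre_digraph.digraph_isomorphism_def)
  ultimately show ?R
    using h(1) by (intro exI[of _ "iso_verts h"]) (auto simp: pre_digraph.digraph_isomorphism_def)
next
  interpret pair_graph G by fact
  assume ?R
  then obtain f where f: "inj_on f (pverts G)" "pverts H = f ` pverts G"
    "parcs H = map_prod f f ` parcs G" by blast
  let ?h = "\<lparr>iso_verts = f, iso_arcs = map_prod f f, iso_head = snd, iso_tail = fst\<rparr>"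
  have "inj_on (map_prod f f) (parcs G)"
    using map_prod_inj_on[OF f(1) f(1)] by (rule inj_on_subset) (auto dest: adjacent_verts)
  moreover have "wf_digraph (with_proj G)" by unfold_locales
  ultimately have "pre_digraph.digraph_isomorphism (with_proj G) ?h"
    using f(1) by (auto simp: pre_digraph.digraph_isomorphism_def)
  moreover have "with_proj H = app_iso ?h (with_proj G)"
    using f by (simp add: with_proj_def app_iso_def)
  ultimately show ?L unfolding digraph_iso_def by blast
qed

lemma graph_iso_obtain:
  assumes "pair_graph G" "graph_iso G H"
  obtains f where "inj_on f (pverts G)" "pverts H = f ` pverts G"
    "\<And>u v. u \<in> pverts G \<Longrightarrow> v \<in> pverts G \<Longrightarrow> (f u, f v) \<in> parcs H \<longleftrightarrow> (u, v) \<in> parcs G"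
proof -
  interpret pair_graph G by fact
  obtain f where f: "inj_on f (pverts G)" "pverts H = f ` pverts G"
    "parcs H = map_prod f f ` parcs G" using assms by (auto simp: graph_iso_iff)
  have "(f u, f v) \<in> parcs H \<longleftrightarrow> (u, v) \<in> parcs G" if "u \<in> pverts G" "v \<in> pverts G" for u v
  proof
    assume "(f u, f v) \<in> parcs H"
    then obtain u' v' where e: "(u', v') \<in> parcs G" "f u = f u'" "f v = f v'" unfolding f(3) by auto
    then have "u = u'" "v = v'" using f(1) that adjacent_verts[OF e(1)] by (auto dest: inj_onD)
    then show "(u, v) \<in> parcs G" using e(1) by simp
  qed (auto simp: f(3))
  then show ?thesis using that f by blast
qed

lemma graph_isoI:
  assumes "pair_graph G" "pair_graph H" "bij_betw f (pverts G) (pverts H)"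
    and "\<And>u v. u \<in> pverts G \<Longrightarrow> v \<in> pverts G \<Longrightarrow> (f u, f v) \<in> parcs H \<longleftrightarrow> (u, v) \<in> parcs G"
  shows "graph_iso G H"
proof -
  interpret pair_graph G by fact
  interpret H: pair_graph H by fact
  have im: "pverts H = f ` pverts G" using assms(3) by (simp add: bij_betw_def)
  have "parcs H = map_prod f f ` parcs G"
  proof (intro set_eqI iffI)
    fix e assume "e \<in> parcs H"
    then obtain u v where "u \<in> pverts G" "v \<in> pverts G" "e = (f u, f v)"
      using H.adjacent_verts im by (cases e) blast
    then show "e \<in> map_prod f f ` parcs G" using assms(4) \<open>e \<in> parcs H\<close> by (auto intro!: rev_image_eqI)
  qed (use assms(4) in \<open>auto dest: adjacent_verts\<close>)
  then show ?thesis using assms(1,3) im by (auto simp: graph_iso_iff bij_betw_def)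
qed

lemma graph_iso_card: "pair_graph G \<Longrightarrow> graph_iso G H \<Longrightarrow> card (pverts H) = card (pverts G)"
  by (metis graph_iso_obtain card_image)

lemma graph_iso_complement:
  assumes "pair_graph G" "pair_graph H" "graph_iso G H"
  shows "graph_iso (complement G) (complement H)"
proof -
  obtain f where f: "inj_on f (pverts G)" "pverts H = f ` pverts G"
    "\<And>u v. u \<in> pverts G \<Longrightarrow> v \<in> pverts G \<Longrightarrow> (f u, f v) \<in> parcs H \<longleftrightarrow> (u, v) \<in> parcs G"
    using graph_iso_obtain[OF assms(1,3)] by blast
  show ?thesis
    by (rule graph_isoI[where f = f])
       (use assms f in \<open>auto simp: pair_graph_complementI bij_betw_def parcs_complement dest: inj_onD\<close>)
qed

lemma graph_iso_complement_iff:
  assumes "pair_graph G" "pair_graph H"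
  shows "graph_iso (complement G) H \<longleftrightarrow> graph_iso G (complement H)"
  using assms by (metis graph_iso_complement complement_complement pair_graph_complementI)

text \<open>The image of a minimum LD-set is an LD-set, because \<open>f\<close> maps traces to
  traces injectively. The reverse inequality follows from the symmetry of isomorphism.\<close>

lemma LD_number_iso_le:
  assumes "pair_graph G" "pair_graph H" "graph_iso G H"
  shows "LD_number H \<le> LD_number G"
proof -
  interpret pair_graph G by fact
  interpret H: pair_graph H by fact
  obtain f where f: "inj_on f (pverts G)" "pverts H = f ` pverts G"
    "\<And>u v. u \<in> pverts G \<Longrightarrow> v \<in> pverts G \<Longrightarrow> (f u, f v) \<in> parcs H \<longleftrightarrow> (u, v) \<in> parcs G"
    using graph_iso_obtain[OF assms(1,3)] by blast
  obtain D where D: "LD_set G D" "card D = LD_number G" by (rule LD_number_attained)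
  have sub: "D \<subseteq> pverts G" using D by (simp add: LD_set_def)
  have tr: "nbhd H (f u) \<inter> f ` D = f ` (nbhd G u \<inter> D)" if "u \<in> pverts G" for u
    using that f(3) sub by (auto simp: nbhd_def)
  have out: "pverts H - f ` D = f ` (pverts G - D)"
    using f(1,2) sub by (auto simp: inj_on_image_set_diff)
  have "LD_set H (f ` D)"
    unfolding LD_set_def out
  proof (intro conjI ballI impI)
    show "f ` D \<subseteq> pverts H" using f(2) sub by auto
  next
    fix u assume "u \<in> f ` (pverts G - D)"
    then obtain u' where u': "u = f u'" "u' \<in> pverts G - D" by blast
    then show "nbhd H u \<inter> f ` D \<noteq> {}" using tr D(1) by (auto simp: LD_set_def)
    fix w assume "w \<in> f ` (pverts G - D)" "u \<noteq> w"
    then obtain w' where w': "w = f w'" "w' \<in> pverts G - D" "u' \<noteq> w'" using u' by blast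
    then have "nbhd G u' \<inter> D \<noteq> nbhd G w' \<inter> D" using u' D(1) by (auto simp: LD_set_def)
    then have "f ` (nbhd G u' \<inter> D) \<noteq> f ` (nbhd G w' \<inter> D)"
      using inj_on_image_eq_iff[OF f(1)] sub by (metis inf.coboundedI2)
    then show "nbhd H u \<inter> f ` D \<noteq> nbhd H w \<inter> f ` D" using tr u' w' by simp
  qed
  then have "LD_number H \<le> card (f ` D)" by (rule H.LD_number_le)
  also have "\<dots> = LD_number G" using D f(1) sub by (metis card_image inj_on_subset)
  finally show ?thesis .
qed

lemma graph_iso_sym:
  assumes "pair_graph G" "graph_iso G H"
  shows "graph_iso H G"
proof -
  interpret pair_graph G by fact
  have "wf_digraph (with_proj G)" by unfold_locales
  then show ?thesis using assms(2) by (rule digraph_iso_swap)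
qed

lemma LD_number_iso:
  assumes "pair_graph G" "pair_graph H" "graph_iso G H"
  shows "LD_number G = LD_number H"
  using assms LD_number_iso_le graph_iso_sym by (metis le_antisym)

section \<open>Induced paths on four vertices when \<lambda> is at least n - 2\<close>

context pair_graph begin

text \<open>By contradiction: split the vertices other than some \<open>v\<close> into neighbours
  \<open>A\<close> and non-neighbours \<open>B\<close>, and let \<open>T\<close> be a smallest trace
  on \<open>A\<close> of a vertex of \<open>B\<close>. If \<open>T\<close> is not completely joined
  to \<open>B\<close>, three traces on \<open>A\<close> are distinct; if it is, a non-edge leaving
  \<open>T\<close> yields an induced path.\<close>

lemma induced_P4_exists:
  assumes few: "card (pverts G) < LD_number G + 3"
    and dc: "doubly_connected G" and two: "card (pverts G) \<ge> 2"
  obtains (P4) v a b z where "v \<sim> a" "a \<sim> b" "b \<sim> z" "\<not> v \<sim> b" "\<not> a \<sim> z" "\<not> v \<sim> z"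
proof (rule ccontr)
  assume "\<not> thesis"
  then have no_P4: "v \<sim> z" if "v \<sim> a" "a \<sim> b" "b \<sim> z" "\<not> v \<sim> b" "\<not> a \<sim> z" for v a b z
    using P4 that by blast
  have con: "Digraph_Component.connected (with_proj G)"
    and co: "Digraph_Component.connected (with_proj (complement G))"
    using dc by (auto simp: doubly_connected_def)
  obtain v where v: "v \<in> pverts G" using two by fastforce
  define A where "A = nbhd G v"
  define B where "B = {b \<in> pverts G. b \<noteq> v \<and> \<not> v \<sim> b}"
  have A_iff: "x \<in> A \<longleftrightarrow> v \<sim> x" for x by (simp add: A_def nbhd_def)
  have fin: "finite A"
    by (rule finite_subset[OF _ pair_finite_verts]) (auto simp: A_iff dest: adjacent_verts)
  have "{v} \<noteq> pverts G"
  proof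
    assume "{v} = pverts G"
    then have "card (pverts G) = 1" by (metis card_1_singleton_iff One_nat_def)
    then show False using two by simp
  qed
  then obtain w where "w \<in> pverts G" "w \<noteq> v" "\<not> v \<sim> w"
    using co_connected_cut[OF co, of "{v}"] v by auto
  then have "B \<noteq> {}" by (auto simp: B_def)
  have trace_ne: "\<exists>a\<in>A. b \<sim> a" if b: "b \<in> B" for b
  proof (rule ccontr)
    assume empty: "\<not> ?thesis"
    \<comment> \<open>\<open>X\<close> is the ball of radius two around \<open>v\<close>. An edge
      \<open>u\<close>, \<open>e\<close> leaving it would complete an induced path
      \<open>v - a - u - e\<close>.\<close>
    define X where "X = {v} \<union> A \<union> {b \<in> B. \<exists>a\<in>A. b \<sim> a}"
    have "X \<subseteq> pverts G" using v adjacent_verts(2)[of v] by (auto simp: X_def A_iff B_def)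
    moreover have "b \<notin> X" "b \<in> pverts G" using b empty by (auto simp: X_def A_iff B_def)
    moreover have "X \<noteq> {}" by (simp add: X_def)
    ultimately obtain u e where u: "u \<in> X" and e: "e \<in> pverts G - X" "u \<sim> e"
      using connected_cut[OF con, of X] by metis
    have "e \<noteq> v" "\<not> v \<sim> e" using e by (auto simp: X_def A_iff)
    then have "e \<in> B" using e by (simp add: B_def)
    have e_empty: "\<not> a \<sim> e" if "a \<in> A" for a
      using e that \<open>e \<in> B\<close> adjacent_sym by (auto simp: X_def)
    with u e \<open>\<not> v \<sim> e\<close> obtain a where "u \<in> B" "a \<in> A" "u \<sim> a" by (auto simp: X_def)
    then show False
      using no_P4[of v a u e] e e_empty \<open>\<not> v \<sim> e\<close> adjacent_sym by (auto simp: A_iff B_def)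
  qed
  from \<open>B \<noteq> {}\<close> obtain b' where "b' \<in> B" by blast
  from ex_has_least_nat[of "\<lambda>b. b \<in> B", OF this, of "\<lambda>b. card (nbhd G b \<inter> A)"]
  obtain b0 where b0: "b0 \<in> B"
    and b0_min: "\<And>b. b \<in> B \<Longrightarrow> card (nbhd G b0 \<inter> A) \<le> card (nbhd G b \<inter> A)"
    by blast
  define T where "T = nbhd G b0 \<inter> A"
  have T_iff: "x \<in> T \<longleftrightarrow> b0 \<sim> x \<and> v \<sim> x" for x by (auto simp: T_def A_iff nbhd_def)
  \<comment> \<open>Otherwise the traces of \<open>v\<close>, \<open>b0\<close> and \<open>b\<close>
    on \<open>A\<close> are \<open>A\<close>, \<open>T\<close> and a set without \<open>t\<close>.
    Minimality of \<open>T\<close> is what excludes \<open>T = A\<close>: the trace of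
    \<open>b\<close> is a proper subset of \<open>A\<close> and at least as large as
    \<open>T\<close>.\<close>
  have T_B: "b \<sim> t" if "b \<in> B" "t \<in> T" for b t
  proof (rule ccontr)
    assume "\<not> b \<sim> t"
    then have "t \<in> A" "t \<notin> nbhd G b" using that(2) by (simp_all add: nbhd_def T_iff A_iff)
    then have "nbhd G b \<inter> A \<subset> A" by blast
    with fin have "card (nbhd G b \<inter> A) < card A" by (rule psubset_card_mono)
    then have "card T < card A" using b0_min[OF that(1)] by (simp add: T_def)
    then have "T \<noteq> A" "T \<subseteq> A" by (auto simp: T_def)
    then obtain t' where "t' \<in> A" "t' \<notin> T" by blast
    then have t': "v \<sim> t'" "\<not> b0 \<sim> t'" by (simp_all add: T_iff A_iff)
    have "LD_number G + 3 \<le> card (pverts G)"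
    proof (rule LD_number_three_traces[of A v b0 b])
      show "A \<subseteq> pverts G" by (auto simp: A_iff adjacent_verts)
      show "A \<inter> {v, b0, b} = {}" "{v, b0, b} \<subseteq> pverts G"
        using v b0 that(1) by (auto simp: A_iff B_def)
      show "\<exists>d\<in>A. v \<sim> d" "\<exists>d\<in>A. b0 \<sim> d" "\<exists>d\<in>A. b \<sim> d"
        using trace_ne[OF b0] trace_ne[OF that(1)] by (auto simp: A_iff)
      show "\<exists>d\<in>A. (v \<sim> d) \<noteq> (b0 \<sim> d)" using t' by (auto simp: A_iff)
      show "\<exists>d\<in>A. (v \<sim> d) \<noteq> (b \<sim> d)" "\<exists>d\<in>A. (b0 \<sim> d) \<noteq> (b \<sim> d)"
        using that(2) \<open>\<not> b \<sim> t\<close> by (auto simp: A_iff T_iff)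
    qed
    then show False using few by simp
  qed
  \<comment> \<open>\<open>T\<close> is joined to \<open>v\<close> and to all of \<open>B\<close>,
    so a non-edge leaving it ends in a vertex \<open>w\<close> of \<open>A - T\<close>; then
    \<open>b0 - t - v - w\<close> is induced.\<close>
  have "T \<subseteq> pverts G" "v \<notin> T" "T \<noteq> {}"
    using trace_ne[OF b0] by (auto simp: T_iff A_iff adjacent_verts)
  with v obtain t w where t: "t \<in> T" and w: "w \<in> pverts G - T" "\<not> t \<sim> w"
    using co_connected_cut[OF co, of T] by blast
  have "w \<noteq> v" "w \<notin> B" using t w T_B adjacent_sym by (auto simp: T_iff)
  then have "v \<sim> w" "\<not> b0 \<sim> w" using w by (auto simp: B_def T_iff)
  then show False
    using no_P4[of b0 t v w] t w b0 adjacent_sym by (auto simp: T_iff B_def)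
qed

text \<open>Here \<open>x\<close> sees neither \<open>a\<close> nor \<open>b\<close> but has a
  neighbour \<open>y\<close> next to \<open>a\<close>. If \<open>y = v\<close>, the detectors
  \<open>b\<close> and \<open>v\<close> separate \<open>z\<close>, \<open>x\<close> and
  \<open>a\<close>. Otherwise, on \<open>{a, b, y}\<close>, \<open>v\<close> sees \<open>a\<close>
  but not \<open>b\<close>, \<open>z\<close> sees \<open>b\<close> but not \<open>a\<close>, and
  \<open>x\<close> sees only \<open>y\<close>.\<close>

lemma P4_dominated_aux:
  assumes P4: "v \<sim> a" "a \<sim> b" "b \<sim> z" "\<not> v \<sim> b" "\<not> a \<sim> z" "\<not> v \<sim> z"
    and "y \<sim> a" "y \<sim> x" "\<not> x \<sim> a" "\<not> x \<sim> b"
  shows "LD_number G + 3 \<le> card (pverts G)"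
proof (cases "y = v")
  case True
  show ?thesis
    by (rule LD_number_two_detectors[of z b v x a]) (use assms True adjacent_sym in metis)+
next
  case False
  have ne: "v \<noteq> a" "v \<noteq> b" "v \<noteq> y" "z \<noteq> a" "z \<noteq> b" "z \<noteq> y" "x \<noteq> a" "x \<noteq> b" "x \<noteq> y"
    using assms False adjacent_sym adjacent_irrefl by metis+
  have adj: "\<not> z \<sim> a" "z \<sim> b" "x \<sim> y" using assms adjacent_sym by metis+
  show ?thesis
  proof (rule LD_number_three_traces[of "{a, b, y}" v z x])
    show "{a, b, y} \<subseteq> pverts G" "{v, z, x} \<subseteq> pverts G"
      using P4 assms(7,8) by (simp_all add: adjacent_verts)
    show "{a, b, y} \<inter> {v, z, x} = {}" using ne by auto
  qed (use adj assms in simp_all)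
qed

text \<open>A common neighbour of \<open>a\<close> and \<open>b\<close> has trace
  \<open>{a, b}\<close>, while \<open>v\<close> and \<open>z\<close> have traces \<open>{a}\<close>
  and \<open>{b}\<close>.\<close>

lemma P4_no_triangle:
  assumes few: "card (pverts G) < LD_number G + 3"
    and P4: "v \<sim> a" "a \<sim> b" "b \<sim> z" "\<not> v \<sim> b" "\<not> a \<sim> z" "\<not> v \<sim> z"
  shows "\<not> (x \<sim> a \<and> x \<sim> b)"
proof
  assume "x \<sim> a \<and> x \<sim> b"
  then have "LD_number G + 3 \<le> card (pverts G)"
    by (intro LD_number_two_detectors[of v a b z x]) (use P4 adjacent_sym in metis)+
  then show False using few by simp
qed

text \<open>If some vertex sees neither \<open>a\<close> nor \<open>b\<close>, connectivity provides
  such a vertex next to a neighbour of \<open>a\<close> or of \<open>b\<close>. The previous trace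
  argument then applies to the path or to its reversal.\<close>

lemma P4_dominating:
  assumes few: "card (pverts G) < LD_number G + 3"
    and con: "Digraph_Component.connected (with_proj G)"
    and P4: "v \<sim> a" "a \<sim> b" "b \<sim> z" "\<not> v \<sim> b" "\<not> a \<sim> z" "\<not> v \<sim> z"
    and x: "x \<in> pverts G"
  shows "x \<sim> a \<or> x \<sim> b"
proof (rule ccontr)
  assume contra: "\<not> (x \<sim> a \<or> x \<sim> b)"
  define W where "W = {x \<in> pverts G. x \<sim> a \<or> x \<sim> b}"
  have "W \<subseteq> pverts G" "W \<noteq> {}" "W \<noteq> pverts G"
    using P4 x contra adjacent_verts(1)[of v a] by (auto simp: W_def)
  then obtain y x where yx: "y \<in> W" "x \<in> pverts G - W" "y \<sim> x"
    using connected_cut[OF con] by metis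
  then have x: "\<not> x \<sim> a" "\<not> x \<sim> b" and "y \<sim> a \<or> y \<sim> b" by (auto simp: W_def)
  moreover have "z \<sim> b" "b \<sim> a" "a \<sim> v" "\<not> z \<sim> a" "\<not> b \<sim> v" "\<not> z \<sim> v"
    using P4 adjacent_sym by blast+
  ultimately have "LD_number G + 3 \<le> card (pverts G)"
    using P4_dominated_aux[OF P4, of y x] P4_dominated_aux[of z b a v y x] yx(3) by blast
  then show False using few by simp
qed

lemma P4_side_independent:
  assumes few: "card (pverts G) < LD_number G + 3"
    and P4: "v \<sim> a" "a \<sim> b" "b \<sim> z" "\<not> v \<sim> b" "\<not> a \<sim> z" "\<not> v \<sim> z"
    and p: "p \<sim> a" "p \<noteq> b" "p' \<sim> a" "p' \<noteq> b"
  shows "\<not> p \<sim> p'"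
proof
  assume pp: "p \<sim> p'"
  have no_b: "\<not> q \<sim> b" if "q \<sim> a" for q using P4_no_triangle[OF few P4] that by blast
  \<comment> \<open>An edge inside the side of \<open>a\<close> forces both its ends to be adjacent
    to \<open>z\<close>; otherwise \<open>z\<close>, \<open>q'\<close> and \<open>a\<close> have
    traces \<open>{b}\<close>, \<open>{q}\<close> and \<open>{b, q}\<close> on
    \<open>{b, q}\<close>.\<close>
  have z: "z \<sim> q" if "q \<sim> a" "q \<noteq> b" "q' \<sim> a" "q' \<noteq> b" "q \<sim> q'" for q q'
  proof (rule ccontr)
    assume "\<not> z \<sim> q"
    have "LD_number G + 3 \<le> card (pverts G)"
      by (rule LD_number_two_detectors[of z b q q' a])
         (use P4 that no_b[of q] no_b[of q'] \<open>\<not> z \<sim> q\<close> adjacent_sym in metis)+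
    then show False using few by simp
  qed
  have zp: "z \<sim> p" "z \<sim> p'" using z[of p p'] z[of p' p] p pp adjacent_sym by blast+
  have "\<not> v \<sim> p'" using z[of v p'] P4 p adjacent_sym by metis
  have ne: "a \<noteq> p" "a \<noteq> v" "a \<noteq> b" "p' \<noteq> p" "p' \<noteq> v" "p' \<noteq> b" "z \<noteq> p" "z \<noteq> v" "z \<noteq> b"
    using p pp zp P4 adjacent_sym adjacent_irrefl by metis+
  have adj: "b \<sim> a" "\<not> b \<sim> p'" "p \<sim> z" using P4 zp no_b[of p'] p adjacent_sym by metis+
  have "LD_number G + 3 \<le> card (pverts G)"
  \<comment> \<open>The traces of \<open>p\<close>, \<open>v\<close>, \<open>b\<close> are
    \<open>{a, p', z}\<close>, \<open>{a}\<close> and \<open>{a, z}\<close>.\<close>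
  proof (rule LD_number_three_traces[of "{a, p', z}" p v b])
    show "{a, p', z} \<subseteq> pverts G" "{p, v, b} \<subseteq> pverts G"
      using P4 p by (simp_all add: adjacent_verts)
    show "{a, p', z} \<inter> {p, v, b} = {}" using ne by auto
  qed (use adj pp P4 p \<open>\<not> v \<sim> p'\<close> in simp_all)
  then show False using few by simp
qed

text \<open>On \<open>{a, b, p}\<close> the vertex \<open>v\<close> has trace \<open>{a}\<close>,
  while \<open>q\<close> and \<open>z\<close> see \<open>b\<close> but not \<open>a\<close>. If they
  disagreed at \<open>p\<close>, all three traces would be distinct.\<close>

lemma P4_cross_uniform:
  assumes few: "card (pverts G) < LD_number G + 3" and "a \<sim> b"
    and p: "p \<sim> a" "p \<noteq> b" "\<not> p \<sim> b" "v \<sim> a" "v \<noteq> b" "\<not> v \<sim> b" "\<not> v \<sim> p" "p \<noteq> v"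
    and q: "q \<sim> b" "q \<noteq> a" "\<not> q \<sim> a" "z \<sim> b" "z \<noteq> a" "\<not> z \<sim> a"
  shows "q \<sim> p \<longleftrightarrow> z \<sim> p"
proof (rule ccontr)
  assume dif: "\<not> ?thesis"
  have ne: "a \<noteq> v" "a \<noteq> z" "a \<noteq> q" "b \<noteq> v" "b \<noteq> z" "b \<noteq> q" "p \<noteq> v" "p \<noteq> z" "p \<noteq> q"
    using p q \<open>a \<sim> b\<close> adjacent_sym adjacent_irrefl by metis+
  have "LD_number G + 3 \<le> card (pverts G)"
  proof (rule LD_number_three_traces[of "{a, b, p}" v z q])
    show "{a, b, p} \<subseteq> pverts G" "{v, z, q} \<subseteq> pverts G"
      using \<open>a \<sim> b\<close> p q by (simp_all add: adjacent_verts)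
    show "{a, b, p} \<inter> {v, z, q} = {}" using ne by auto
  qed (use dif p q in auto)
  then show False using few by simp
qed

end

section \<open>Recognition of double stars and extended stars\<close>

lemma graph_iso_ugraph:
  assumes "pair_graph (ugraph V E)" "bij_betw f V V'" "map_prod f f ` E = E'"
  shows "graph_iso (ugraph V E) (ugraph V' E')"
proof -
  have "(map_prod f f ` E)\<inverse> = map_prod f f ` E\<inverse>" by force
  then have "E' \<union> E'\<inverse> = map_prod f f ` (E \<union> E\<inverse>)" using assms(3) by (simp add: image_Un)
  then show ?thesis using assms(1,2) by (auto simp: graph_iso_iff bij_betw_def ugraph_def)
qed

lemma ugraph_eqI:
  assumes "pair_graph G" "pverts G = V" "E \<subseteq> parcs G"
    and "\<And>x y. x \<in> V \<Longrightarrow> y \<in> V \<Longrightarrow> (x, y) \<in> parcs G \<Longrightarrow> (x, y) \<in> E \<or> (y, x) \<in> E"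
  shows "G = ugraph V E"
proof -
  interpret pair_graph G by fact
  have "E\<inverse> \<subseteq> parcs G" using assms(3) adjacent_sym by auto
  moreover have "(x, y) \<in> E \<union> E\<inverse>" if "(x, y) \<in> parcs G" for x y
    using assms(4)[of x y] that adjacent_verts[OF that] assms(2) by auto
  ultimately have "parcs G = E \<union> E\<inverse>" using assms(3) by auto
  then show ?thesis
    using assms(2) by (intro pair_pre_digraph.equality) (simp_all add: ugraph_def)
qed

lemma map_prod_image_Times: "map_prod f g ` (A \<times> B) = f ` A \<times> g ` B"
  by (rule map_prod_surj_on) simp_all

text \<open>Bijections of the centres and of the two leaf sets are glued together. The edge set is a
  union of products of these blocks, so its image is computed block by block.\<close>

lemma graph_iso_double_star:
  assumes G: "pair_graph G" "G = ugraph ({a, b} \<union> P \<union> Q) ({(a, b)} \<union> {a} \<times> P \<union> {b} \<times> Q)"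
    and dis: "a \<noteq> b" "{a, b} \<inter> (P \<union> Q) = {}" "P \<inter> Q = {}"
  shows "graph_iso G (double_star (card P) (card Q))"
proof -
  interpret pair_graph G by fact
  have fin: "finite P" "finite Q" using pair_finite_verts by (auto simp: G(2) ugraph_def)
  let ?r = "card P" and ?s = "card Q"
  let ?P = "{2..?r + 1}" and ?Q = "{?r + 2..?r + ?s + 1}"
  obtain g where g: "bij_betw g P ?P" using finite_same_card_bij[OF fin(1), of ?P] by auto
  obtain h where h: "bij_betw h Q ?Q" using finite_same_card_bij[OF fin(2), of ?Q] by auto
  define f where "f x = (if x = a then 0 else if x = b then 1 else if x \<in> P then g x else h x)" for x
  have fab: "f a = 0" "f b = 1" using dis by (auto simp: f_def)
  have "bij_betw f {a, b} {0, 1}" using fab by (auto simp: bij_betw_def)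
  moreover have fP: "bij_betw f P ?P"
    using g dis by (subst bij_betw_cong[of _ _ g]) (auto simp: f_def)
  moreover have fQ: "bij_betw f Q ?Q"
    using h dis by (subst bij_betw_cong[of _ _ h]) (auto simp: f_def)
  ultimately have "bij_betw f ({a, b} \<union> P \<union> Q) ({0, 1} \<union> ?P \<union> ?Q)"
    by (intro bij_betw_combine) auto
  moreover have "{0, 1} \<union> ?P \<union> ?Q = {0..?r + ?s + 1}" by auto
  moreover have "map_prod f f ` ({(a, b)} \<union> {a} \<times> P \<union> {b} \<times> Q) =
      {(0, 1)} \<union> {0} \<times> ?P \<union> {1} \<times> ?Q"
    using fab bij_betw_imp_surj_on[OF fP] bij_betw_imp_surj_on[OF fQ]
    by (simp only: image_Un map_prod_image_Times image_insert image_empty map_prod_simp)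
  ultimately show ?thesis
    unfolding double_star_def G(2) using G by (intro graph_iso_ugraph) simp_all
qed

text \<open>\<open>c\<close> is the centre and \<open>w\<close> the added vertex; \<open>A\<close>
  consists of the leaves joined to \<open>w\<close>, \<open>B\<close> of the others. The bijection
  is glued from blocks as for the double star.\<close>

lemma graph_iso_extended_star:
  assumes G: "pair_graph G" "G = ugraph ({c, w} \<union> A \<union> B) ({c} \<times> (A \<union> B) \<union> {w} \<times> A)"
    and dis: "c \<noteq> w" "{c, w} \<inter> (A \<union> B) = {}" "A \<inter> B = {}"
  shows "graph_iso G (extended_star (card A + card B) (card A))"
proof -
  interpret pair_graph G by fact
  have fin: "finite A" "finite B" using pair_finite_verts by (auto simp: G(2) ugraph_def)
  let ?s = "card A" and ?r = "card A + card B"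
  let ?A = "{1..?s}" and ?B = "{?s + 1..?r}"
  obtain g where g: "bij_betw g A ?A" using finite_same_card_bij[OF fin(1), of ?A] by auto
  obtain h where h: "bij_betw h B ?B" using finite_same_card_bij[OF fin(2), of ?B] by auto
  define f where "f x = (if x = c then 0 else if x = w then ?r + 1 else if x \<in> A then g x else h x)" for x
  have fcw: "f c = 0" "f w = ?r + 1" using dis by (auto simp: f_def)
  have "bij_betw f {c, w} {0, ?r + 1}" using fcw by (auto simp: bij_betw_def)
  moreover have fA: "bij_betw f A ?A"
    using g dis by (subst bij_betw_cong[of _ _ g]) (auto simp: f_def)
  moreover have fB: "bij_betw f B ?B"
    using h dis by (subst bij_betw_cong[of _ _ h]) (auto simp: f_def)
  ultimately have "bij_betw f ({c, w} \<union> A \<union> B) ({0, ?r + 1} \<union> ?A \<union> ?B)"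
    by (intro bij_betw_combine) auto
  moreover have "{0, ?r + 1} \<union> ?A \<union> ?B = {0..?r + 1}" "?A \<union> ?B = {1..?r}" by auto
  moreover have "map_prod f f ` ({c} \<times> (A \<union> B) \<union> {w} \<times> A) =
      {0} \<times> (?A \<union> ?B) \<union> {?r + 1} \<times> ?A"
    using fcw bij_betw_imp_surj_on[OF fA] bij_betw_imp_surj_on[OF fB]
    by (simp only: image_Un map_prod_image_Times image_insert image_empty)
  ultimately show ?thesis
    unfolding extended_star_def G(2) using G by (intro graph_iso_ugraph) simp_all
qed

section \<open>Structure of the graphs with \<lambda> at least n - 2\<close>

context pair_graph begin

text \<open>Around an induced path \<open>v - a - b - z\<close>, the neighbours of \<open>a\<close>
  other than \<open>b\<close> and those of \<open>b\<close> other than \<open>a\<close> form two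
  independent sides that exhaust the remaining vertices. If both sides have at least two vertices,
  there are no edges between them; if one is a single vertex, its edges to the other side decide
  which family occurs.\<close>

lemma large_LD_number_imp_star:
  assumes few: "card (pverts G) < LD_number G + 3"
    and dc: "doubly_connected G" and five: "card (pverts G) \<ge> 5"
  shows "(\<exists>r s. 1 \<le> r \<and> 1 \<le> s \<and> graph_iso G (double_star r s)) \<or>
    (\<exists>r s. 2 \<le> s \<and> s \<le> r - 1 \<and> graph_iso G (extended_star r s))"
proof -
  have G: "pair_graph G" by unfold_locales
  have con: "Digraph_Component.connected (with_proj G)" using dc by (simp add: doubly_connected_def)
  \<comment> \<open>The side of \<open>a\<close> is just \<open>v\<close>. The path is kept
    arbitrary so that the reversed path is covered too.\<close>
  have one_side: ?thesis
    if P4: "v \<sim> a" "a \<sim> b" "b \<sim> z" "\<not> v \<sim> b" "\<not> a \<sim> z" "\<not> v \<sim> z"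
      and only: "\<And>p. p \<sim> a \<Longrightarrow> p = b \<or> p = v" for v a b z
  proof -
    have P4': "z \<sim> b" "b \<sim> a" "a \<sim> v" "\<not> z \<sim> a" "\<not> b \<sim> v" "\<not> z \<sim> v"
      using P4 adjacent_sym by blast+
    define Q where "Q = {x. x \<sim> b \<and> x \<noteq> a}"
    have V: "pverts G = {a, b, v} \<union> Q"
      using P4_dominating[OF few con P4] only adjacent_verts P4 by (auto simp: Q_def)
    have indep: "\<not> q \<sim> q'" if "q \<in> Q" "q' \<in> Q" for q q'
      using that P4_side_independent[OF few P4'] by (simp add: Q_def)
    have ne: "a \<noteq> b" "v \<noteq> a" "v \<noteq> b" "v \<notin> Q" "a \<notin> Q" "b \<notin> Q" "z \<in> Q"
      using P4 P4' by (auto simp: Q_def)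
    define N where "N = {q \<in> Q. q \<sim> v}"
    have z: "z \<in> Q - N" using ne P4' by (auto simp: N_def)
    have fin: "finite Q" using pair_finite_verts by (simp add: V)
    have no_aQ: "\<not> a \<sim> q" "\<not> q \<sim> a" if "q \<in> Q" for q
      using that only[of q] adjacent_sym ne by blast+
    have Qb: "q \<sim> b" "b \<sim> q" if "q \<in> Q" for q using that adjacent_sym by (auto simp: Q_def)
    show ?thesis
    proof (cases "N = {}")
      case True
      have "G = ugraph ({a, b} \<union> {v} \<union> Q) ({(a, b)} \<union> {a} \<times> {v} \<union> {b} \<times> Q)"
      proof (rule ugraph_eqI[OF G])
        fix x y assume xy: "x \<in> {a, b} \<union> {v} \<union> Q" "y \<in> {a, b} \<union> {v} \<union> Q" "x \<sim> y"
        have "\<not> q \<sim> v" "\<not> v \<sim> q" if "q \<in> Q" for q using that True adjacent_sym by (auto simp: N_def)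
        note non = this no_aQ indep P4(4) P4'(5)
        show "(x, y) \<in> {(a, b)} \<union> {a} \<times> {v} \<union> {b} \<times> Q \<or> (y, x) \<in> {(a, b)} \<union> {a} \<times> {v} \<union> {b} \<times> Q"
          using xy by (elim UnE insertE emptyE) (simp_all add: non)
      qed (use V P4 P4' Qb in auto)
      from graph_iso_double_star[OF G this] have "graph_iso G (double_star 1 (card Q))"
        using ne by simp
      moreover have "card Q \<ge> 1" using ne fin by (metis One_nat_def Suc_leI card_gt_0_iff empty_iff)
      ultimately show ?thesis by blast
    next
      case False
      \<comment> \<open>Now \<open>b\<close> is the centre and \<open>v\<close> the added vertex,
        with \<open>A\<close> their common neighbours. Both \<open>a\<close> and the nonempty
        \<open>N\<close> contribute to \<open>A\<close>, whence \<open>2 \<le> s\<close>; the leaf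
        \<open>z\<close> is not adjacent to \<open>v\<close>, whence
        \<open>s \<le> r - 1\<close>.\<close>
      define A where "A = insert a N"
      have NQ: "N \<subseteq> Q" by (auto simp: N_def)
      have Nv: "v \<sim> q" if "q \<in> N" for q using that adjacent_sym by (auto simp: N_def)
      have AB: "A \<union> (Q - N) = insert a Q" using NQ by (auto simp: A_def)
      have "G = ugraph ({b, v} \<union> A \<union> (Q - N)) ({b} \<times> (A \<union> (Q - N)) \<union> {v} \<times> A)"
        unfolding Un_assoc AB
      proof (rule ugraph_eqI[OF G])
        fix x y assume xy: "x \<in> {b, v} \<union> insert a Q" "y \<in> {b, v} \<union> insert a Q" "x \<sim> y"
        have "q \<in> N" if "q \<in> Q" "q \<sim> v \<or> v \<sim> q" for q
          using that adjacent_sym by (auto simp: N_def)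
        then show "(x, y) \<in> {b} \<times> insert a Q \<union> {v} \<times> A \<or> (y, x) \<in> {b} \<times> insert a Q \<union> {v} \<times> A"
          using xy by (elim UnE insertE emptyE) (simp_all add: A_def no_aQ indep P4(4) P4'(5))
      qed (use V P4 P4' Qb Nv in \<open>auto simp: A_def\<close>)
      from graph_iso_extended_star[OF G this]
      have "graph_iso G (extended_star (card A + card (Q - N)) (card A))"
        using ne NQ by (auto simp: A_def)
      moreover have "card A = card N + 1"
        using ne NQ fin by (auto simp: A_def finite_subset card_insert_if)
      moreover have "card N \<ge> 1" using False NQ fin
        by (metis One_nat_def Suc_leI card_gt_0_iff finite_subset)
      moreover have "card (Q - N) \<ge> 1" using z fin
        by (metis One_nat_def Suc_leI card_gt_0_iff empty_iff finite_Diff)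
      ultimately show ?thesis by (intro disjI2 exI[of _ "card A + card (Q - N)"] exI[of _ "card A"]) auto
    qed
  qed
  have "card (pverts G) \<ge> 2" using five by simp
  then obtain v a b z where P4: "v \<sim> a" "a \<sim> b" "b \<sim> z" "\<not> v \<sim> b" "\<not> a \<sim> z" "\<not> v \<sim> z"
    by (rule induced_P4_exists[OF few dc])
  have P4': "z \<sim> b" "b \<sim> a" "a \<sim> v" "\<not> z \<sim> a" "\<not> b \<sim> v" "\<not> z \<sim> v"
    using P4 adjacent_sym by blast+
  consider "\<And>p. p \<sim> a \<Longrightarrow> p = b \<or> p = v" | "\<And>q. q \<sim> b \<Longrightarrow> q = a \<or> q = z"
    | p0 q0 where "p0 \<sim> a" "p0 \<noteq> b" "p0 \<noteq> v" "q0 \<sim> b" "q0 \<noteq> a" "q0 \<noteq> z" by blast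
  then show ?thesis
  proof cases
    case 1
    then show ?thesis using one_side[OF P4] by blast
  next
    case 2
    then show ?thesis using one_side[OF P4'] by blast
  next
    case 3
    define P where "P = {x. x \<sim> a \<and> x \<noteq> b}"
    define Q where "Q = {x. x \<sim> b \<and> x \<noteq> a}"
    have V: "pverts G = {a, b} \<union> P \<union> Q"
      using P4_dominating[OF few con P4] adjacent_verts P4 by (auto simp: P_def Q_def)
    have P: "p \<sim> a" "a \<sim> p" "p \<noteq> b" "\<not> p \<sim> b" "\<not> b \<sim> p" if "p \<in> P" for p
      using that P4_no_triangle[OF few P4, of p] adjacent_sym by (auto simp: P_def)
    have Q: "q \<sim> b" "b \<sim> q" "q \<noteq> a" "\<not> q \<sim> a" "\<not> a \<sim> q" if "q \<in> Q" for q
      using that P4_no_triangle[OF few P4, of q] adjacent_sym by (auto simp: Q_def)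
    have vz: "v \<in> P" "z \<in> Q" using P4 P4' by (auto simp: P_def Q_def)
    have pq0: "p0 \<in> P" "q0 \<in> Q" using 3 by (auto simp: P_def Q_def)
    have indep: "\<not> x \<sim> y" if "x \<in> P \<and> y \<in> P \<or> x \<in> Q \<and> y \<in> Q" for x y
      using that P4_side_independent[OF few P4, of x y] P4_side_independent[OF few P4', of x y]
      by (auto simp: P_def Q_def)
    have unifP: "q \<sim> p \<longleftrightarrow> z \<sim> p" if "p \<in> P" "q \<in> Q" for p q
    proof -
      \<comment> \<open>A second vertex on the side of \<open>p\<close> is what the uniformity
        argument needs: it has trace \<open>{a}\<close> on \<open>{a, b, p}\<close>. One of
        \<open>v\<close> and \<open>p0\<close> serves.\<close>
      obtain p' where "p' \<in> P" "p \<noteq> p'" using pq0 vz 3(3) by (cases "p = v") auto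
      then show ?thesis
        using that vz by (intro P4_cross_uniform[OF few P4(2), of p p' q z]) (simp_all add: P Q indep)
    qed
    have unifQ: "p \<sim> q \<longleftrightarrow> v \<sim> q" if "p \<in> P" "q \<in> Q" for p q
    proof -
      obtain q' where "q' \<in> Q" "q \<noteq> q'" using pq0 vz 3(6) by (cases "q = z") auto
      then show ?thesis
        using that vz by (intro P4_cross_uniform[OF few P4'(2), of q q' p v]) (simp_all add: P Q indep)
    qed
    \<comment> \<open>Uniformity first replaces \<open>q\<close> by \<open>z\<close>, then
      \<open>p\<close> by \<open>v\<close>, and \<open>v\<close> and \<open>z\<close> are not
      adjacent.\<close>
    have cross: "\<not> p \<sim> q" "\<not> q \<sim> p" if "p \<in> P" "q \<in> Q" for p q
      using unifP[OF that] unifQ[OF that(1) vz(2)] adjacent_sym P4(6) by blast+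
    have ne: "a \<notin> P" "b \<notin> P" "a \<notin> Q" "b \<notin> Q" "a \<noteq> b" "P \<inter> Q = {}"
      using P Q P4 adjacent_irrefl by blast+
    have "G = ugraph ({a, b} \<union> P \<union> Q) ({(a, b)} \<union> {a} \<times> P \<union> {b} \<times> Q)"
    proof (rule ugraph_eqI[OF G])
      fix x y assume xy: "x \<in> {a, b} \<union> P \<union> Q" "y \<in> {a, b} \<union> P \<union> Q" "x \<sim> y"
      show "(x, y) \<in> {(a, b)} \<union> {a} \<times> P \<union> {b} \<times> Q \<or> (y, x) \<in> {(a, b)} \<union> {a} \<times> P \<union> {b} \<times> Q"
        using xy by (elim UnE insertE emptyE) (simp_all add: P Q cross indep)
    qed (use V P4 P Q in auto)
    from graph_iso_double_star[OF G this] have "graph_iso G (double_star (card P) (card Q))"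
      using ne by auto
    moreover have "finite P" "finite Q" using pair_finite_verts by (simp_all add: V)
    then have "card P \<ge> 1" "card Q \<ge> 1" using vz by (auto simp: Suc_le_eq card_gt_0_iff)
    ultimately show ?thesis by blast
  qed
qed

end

section \<open>Location-domination numbers of the star families and their complements\<close>

lemma (in pair_graph) card_le_LD_number_plus_2:
  assumes "\<And>D. LD_set G D \<Longrightarrow> \<exists>p q. pverts G - D \<subseteq> {p, q}"
  shows "card (pverts G) \<le> LD_number G + 2"
proof -
  obtain D where D: "LD_set G D" "card D = LD_number G" by (rule LD_number_attained)
  obtain p q where "pverts G - D \<subseteq> {p, q}" using assms D by blast
  then have "card (pverts G - D) \<le> card {p, q}" by (rule card_mono[rotated]) simp
  also have "card {p, q} \<le> 2" by (simp add: card_insert_if)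
  finally have "card (pverts G - D) \<le> 2" .
  moreover have "finite D" using D finite_subset[OF _ pair_finite_verts] by (simp add: LD_set_def)
  ultimately show ?thesis using D(2) diff_card_le_card_Diff[of D "pverts G"] by simp
qed

text \<open>Two members of \<open>X\<close> outside \<open>D\<close> would not be separated. This
  bounds how many leaves of one kind an LD-set can omit.\<close>

lemma LD_set_same_trace:
  assumes D: "LD_set G D" and X: "\<And>x. x \<in> X \<Longrightarrow> nbhd G x \<inter> D = T"
  obtains p where "(pverts G - D) \<inter> X \<subseteq> {p}"
proof (cases "(pverts G - D) \<inter> X = {}")
  case False
  then obtain p where p: "p \<in> pverts G - D" "p \<in> X" by blast
  have "x = p" if "x \<in> pverts G - D" "x \<in> X" for x
    using D that p X[of x] X[of p] unfolding LD_set_def by blast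
  then show ?thesis using that by blast
qed (use that in blast)

lemma LD_set_empty_trace:
  "LD_set G D \<Longrightarrow> (\<And>x. x \<in> X \<Longrightarrow> nbhd G x \<inter> D = {}) \<Longrightarrow> (pverts G - D) \<inter> X = {}"
  unfolding LD_set_def by blast

lemma card_double_star: "card (pverts (double_star r s)) = r + s + 2"
  by (simp add: double_star_def ugraph_def)

text \<open>An LD-set omits at most one leaf per centre, and none at an omitted centre, since a leaf
  is dominated only by itself or its centre. So each centre together with its leaves accounts for at
  most one omitted vertex.\<close>

lemma LD_number_double_star: "r + s \<le> LD_number (double_star r s)"
proof -
  let ?G = "double_star r s"
  interpret pair_graph ?G by (rule pair_graph_examples)
  have P: "nbhd ?G x = {0}" if "x \<in> {2..r + 1}" for x
    using that by (auto simp: nbhd_def double_star_def ugraph_def)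
  have Q: "nbhd ?G x = {1}" if "x \<in> {r + 2..r + s + 1}" for x
    using that by (auto simp: nbhd_def double_star_def ugraph_def)
  have V: "pverts ?G = {0, 1} \<union> {2..r + 1} \<union> {r + 2..r + s + 1}"
    by (auto simp: double_star_def ugraph_def)
  have "card (pverts ?G) \<le> LD_number ?G + 2"
  proof (rule card_le_LD_number_plus_2)
    fix D assume D: "LD_set ?G D"
    let ?S = "pverts ?G - D"
    obtain p where p: "?S \<inter> {2..r + 1} \<subseteq> {p}"
      using LD_set_same_trace[OF D, of "{2..r + 1}" "{0} \<inter> D"] P by metis
    obtain q where q: "?S \<inter> {r + 2..r + s + 1} \<subseteq> {q}"
      using LD_set_same_trace[OF D, of "{r + 2..r + s + 1}" "{1} \<inter> D"] Q by metis
    have p0: "?S \<inter> {2..r + 1} = {}" if "0 \<notin> D"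
      by (rule LD_set_empty_trace[OF D]) (use P that in simp)
    have q1: "?S \<inter> {r + 2..r + s + 1} = {}" if "1 \<notin> D"
      by (rule LD_set_empty_trace[OF D]) (use Q that in simp)
    have S: "x = 0 \<or> x = 1 \<or> x \<in> {2..r + 1} \<or> x \<in> {r + 2..r + s + 1}" if "x \<in> ?S" for x
      using that V by blast
    show "\<exists>p q. ?S \<subseteq> {p, q}"
    proof (cases "0 \<in> D"; cases "1 \<in> D")
      assume "0 \<in> D" "1 \<in> D" then have "?S \<subseteq> {p, q}" using S p q by blast
      then show ?thesis by blast
    next
      assume "0 \<in> D" "1 \<notin> D" then have "?S \<subseteq> {1, p}" using S p q1 by blast
      then show ?thesis by blast
    next
      assume "0 \<notin> D" "1 \<in> D" then have "?S \<subseteq> {0, q}" using S q p0 by blast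
      then show ?thesis by blast
    next
      assume "0 \<notin> D" "1 \<notin> D" then have "?S \<subseteq> {0, 1}" using S p0 q1 by blast
      then show ?thesis by blast
    qed
  qed
  then show ?thesis by (simp add: card_double_star)
qed

lemma LD_number_complement_double_star:
  assumes "1 \<le> r" "1 \<le> s" "r + s \<ge> 3"
  shows "LD_number (complement (double_star r s)) + 3 \<le> r + s + 2"
proof -
  interpret pair_graph "complement (double_star r s)"
    by (intro pair_graph_complementI pair_graph_examples)
  note adj = parcs_complement double_star_def ugraph_def
  have "LD_number (complement (double_star r s)) + 3 \<le> card (pverts (complement (double_star r s)))"
  \<comment> \<open>The detectors are one leaf of each centre. In the complement each centre sees
    only the leaf of the other, and a further leaf sees both; the case distinction finds a centre
    with that second leaf.\<close>
  proof (cases "r \<ge> 2")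
    case True
    then show ?thesis
      using assms by (intro LD_number_two_detectors[of 0 "r + 2" 3 1 2]) (auto simp: adj)
  next
    case False
    then have "r = 1" "s \<ge> 2" using assms by auto
    then show ?thesis
      by (intro LD_number_two_detectors[of 0 "r + 3" 2 1 "r + 2"]) (auto simp: adj)
  qed
  then show ?thesis by (simp add: card_double_star)
qed

lemma card_extended_star: "card (pverts (extended_star r s)) = r + 2"
  by (simp add: extended_star_def ugraph_def)

lemma LD_number_extended_star:
  assumes "s \<le> r" shows "r \<le> LD_number (extended_star r s)"
proof -
  let ?G = "extended_star r s"
  interpret pair_graph ?G using assms by (rule pair_graph_examples)
  have A: "nbhd ?G x = {0, r + 1}" if "x \<in> {1..s}" for x
    using that assms by (auto simp: nbhd_def extended_star_def ugraph_def)
  have B: "nbhd ?G x = {0}" if "x \<in> {s + 1..r}" for x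
    using that assms by (auto simp: nbhd_def extended_star_def ugraph_def)
  have V: "pverts ?G = {0, r + 1} \<union> {1..s} \<union> {s + 1..r}"
    using assms by (auto simp: extended_star_def ugraph_def)
  have "card (pverts ?G) \<le> LD_number ?G + 2"
  proof (rule card_le_LD_number_plus_2)
    fix D assume D: "LD_set ?G D"
    let ?S = "pverts ?G - D"
    obtain p where p: "?S \<inter> {1..s} \<subseteq> {p}"
      using LD_set_same_trace[OF D, of "{1..s}" "{0, r + 1} \<inter> D"] A by metis
    obtain q where q: "?S \<inter> {s + 1..r} \<subseteq> {q}"
      using LD_set_same_trace[OF D, of "{s + 1..r}" "{0} \<inter> D"] B by metis
    have B0: "?S \<inter> {s + 1..r} = {}" if "0 \<notin> D"
      by (rule LD_set_empty_trace[OF D]) (use B that in simp)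
    have A0: "?S \<inter> {1..s} = {}" if "0 \<notin> D" "r + 1 \<notin> D"
      by (rule LD_set_empty_trace[OF D]) (use A that in simp)
    have S: "x = 0 \<or> x = r + 1 \<or> x \<in> {1..s} \<or> x \<in> {s + 1..r}" if "x \<in> ?S" for x
      using that V by blast
    show "\<exists>p q. ?S \<subseteq> {p, q}"
    proof (cases "0 \<in> D"; cases "r + 1 \<in> D")
      assume "0 \<in> D" "r + 1 \<in> D" then have "?S \<subseteq> {p, q}" using S p q by blast
      then show ?thesis by blast
    next
      assume D0: "0 \<in> D" "r + 1 \<notin> D"
      \<comment> \<open>Without \<open>r + 1\<close> in \<open>D\<close> the two kinds of leaves
        have the same trace, so at most one leaf in all is omitted.\<close>
      have tr: "nbhd ?G x \<inter> D = {0}" if "x \<in> {1..s} \<union> {s + 1..r}" for x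
        using A B D0 that by blast
      obtain t where "?S \<inter> ({1..s} \<union> {s + 1..r}) \<subseteq> {t}"
      using LD_set_same_trace[OF D tr] .
      then have "?S \<subseteq> {r + 1, t}" using S D0 by blast
      then show ?thesis by blast
    next
      assume "0 \<notin> D" "r + 1 \<in> D" then have "?S \<subseteq> {0, p}" using S p B0 by blast
      then show ?thesis by blast
    next
      assume "0 \<notin> D" "r + 1 \<notin> D" then have "?S \<subseteq> {0, r + 1}" using S A0 B0 by blast
      then show ?thesis by blast
    qed
  qed
  then show ?thesis by (simp add: card_extended_star)
qed

lemma LD_number_complement_extended_star:
  assumes "2 \<le> s" "s \<le> r - 1"
  shows "LD_number (complement (extended_star r s)) + 3 \<le> r + 2"
proof -
  have "s \<le> r" using assms by simp
  then interpret pair_graph "complement (extended_star r s)"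
    by (intro pair_graph_complementI pair_graph_examples)
  have "LD_number (complement (extended_star r s)) + 3 \<le> card (pverts (complement (extended_star r s)))"
    \<comment> \<open>In the complement the centre \<open>0\<close> sees only the detector
      \<open>r + 1\<close>, the leaf \<open>1\<close> sees only the leaf \<open>2\<close>, and the
      leaf \<open>r\<close>, not joined to \<open>r + 1\<close> in the extended star, sees
      both.\<close>
    using assms by (intro LD_number_two_detectors[of 0 "r + 1" 2 1 r])
      (auto simp: parcs_complement extended_star_def ugraph_def)
  then show ?thesis by (simp add: card_extended_star)
qed

text \<open>The two numbers differ by at most 1, so the bounds pin them to n - 2 and n - 3.\<close>

lemma sum_LD_number_eq:
  assumes "pair_graph G" "card (pverts G) \<ge> 5"
    and "card (pverts G) \<le> LD_number G + 2" "LD_number (complement G) + 3 \<le> card (pverts G)"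
  shows "LD_number G + LD_number (complement G) = 2 * card (pverts G) - 5"
proof -
  have "LD_number G \<le> LD_number (complement G) + 1"
    using pair_graph.LD_number_complement_le[OF pair_graph_complementI[OF assms(1)]]
    by (simp add: complement_complement assms(1))
  then show ?thesis using assms by linarith
qed

lemma sum_LD_number_star:
  assumes G: "pair_graph G" "card (pverts G) \<ge> 5"
    and star: "(\<exists>r s. 1 \<le> r \<and> 1 \<le> s \<and> graph_iso G (double_star r s)) \<or>
      (\<exists>r s. 2 \<le> s \<and> s \<le> r - 1 \<and> graph_iso G (extended_star r s))"
  shows "LD_number G + LD_number (complement G) = 2 * card (pverts G) - 5"
proof (rule sum_LD_number_eq[OF G])
  have LD: "LD_number G = LD_number H" "LD_number (complement G) = LD_number (complement H)"
    "card (pverts H) = card (pverts G)" if "graph_iso G H" "pair_graph H" for H :: "nat pair_pre_digraph"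
    using G(1) that by (auto intro: LD_number_iso graph_iso_complement pair_graph_complementI graph_iso_card)
  from star have "card (pverts G) \<le> LD_number G + 2 \<and> LD_number (complement G) + 3 \<le> card (pverts G)"
  proof (elim disjE exE conjE)
    fix r s :: nat assume rs: "1 \<le> r" "1 \<le> s" "graph_iso G (double_star r s)"
    note LD = LD[OF rs(3) pair_graph_examples(4)]
    have "card (pverts G) = r + s + 2" using LD card_double_star by simp
    then show ?thesis using LD LD_number_double_star[of r s]
        LD_number_complement_double_star[OF rs(1,2)] G(2) by simp
  next
    fix r s :: nat assume rs: "2 \<le> s" "s \<le> r - 1" "graph_iso G (extended_star r s)"
    then have "s \<le> r" by simp
    note LD = LD[OF rs(3) pair_graph_examples(5)[OF this]]
    have "card (pverts G) = r + 2" using LD card_extended_star by simp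
    then show ?thesis using LD LD_number_extended_star[OF \<open>s \<le> r\<close>]
        LD_number_complement_extended_star[OF rs(1,2)] by simp
  qed
  then show "card (pverts G) \<le> LD_number G + 2" "LD_number (complement G) + 3 \<le> card (pverts G)"
    by simp_all
qed

section \<open>Graphs on five vertices and the sum 4\<close>

text \<open>The ten equivalences cover every unordered pair once; symmetry and irreflexivity give
  the rest. The order in which the vertices are listed selects the isomorphism.\<close>

lemma graph_iso_five:
  fixes H :: "nat pair_pre_digraph"
  assumes G: "pair_graph G" "pverts G = {v0, v1, v2, v3, v4}" "distinct [v0, v1, v2, v3, v4]"
    and H: "pair_graph H" "pverts H = {0..4}"
    and adj: "(v0, v1) \<in> parcs G \<longleftrightarrow> (0, 1) \<in> parcs H" "(v0, v2) \<in> parcs G \<longleftrightarrow> (0, 2) \<in> parcs H"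
      "(v0, v3) \<in> parcs G \<longleftrightarrow> (0, 3) \<in> parcs H" "(v0, v4) \<in> parcs G \<longleftrightarrow> (0, 4) \<in> parcs H"
      "(v1, v2) \<in> parcs G \<longleftrightarrow> (1, 2) \<in> parcs H" "(v1, v3) \<in> parcs G \<longleftrightarrow> (1, 3) \<in> parcs H"
      "(v1, v4) \<in> parcs G \<longleftrightarrow> (1, 4) \<in> parcs H" "(v2, v3) \<in> parcs G \<longleftrightarrow> (2, 3) \<in> parcs H"
      "(v2, v4) \<in> parcs G \<longleftrightarrow> (2, 4) \<in> parcs H" "(v3, v4) \<in> parcs G \<longleftrightarrow> (3, 4) \<in> parcs H"
  shows "graph_iso G H"
proof -
  interpret pair_graph G by fact
  interpret H: pair_graph H by fact
  have five: "{0..4} = {0, 1, 2, 3, 4::nat}" by auto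
  define f :: "'a \<Rightarrow> nat" where "f x = (if x = v0 then 0 else if x = v1 then 1 else if x = v2 then 2
    else if x = v3 then 3 else 4)" for x
  have f: "f v0 = 0" "f v1 = 1" "f v2 = 2" "f v3 = 3" "f v4 = 4" using G(3) by (auto simp: f_def)
  have flip: "(y, x) \<in> parcs G \<longleftrightarrow> (j, i) \<in> parcs H"
    if "(x, y) \<in> parcs G \<longleftrightarrow> (i, j) \<in> parcs H" for x y i j
    using that adjacent_sym[of x y] H.adjacent_sym[of i j] by blast
  note table = adj adj[THEN flip] adjacent_irrefl H.adjacent_irrefl
  have "bij_betw f (pverts G) (pverts H)"
    unfolding bij_betw_def G(2) H(2) five using G(3) by (auto simp: f inj_on_def)
  moreover have "(f u, f v) \<in> parcs H \<longleftrightarrow> (u, v) \<in> parcs G" if "u \<in> pverts G" "v \<in> pverts G" for u v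
  proof -
    show ?thesis
      using that unfolding G(2) by (elim insertE emptyE) (simp_all only: f table)
  qed
  ultimately show ?thesis using G(1) H(1) by (intro graph_isoI)
qed

lemma five_vertex_examples:
  "pverts path5 = {0..4}" "pverts cycle5 = {0..4}" "pverts bull = {0..4}" "pverts house = {0..4}"
  "parcs path5 = {(0, 1), (1, 2), (2, 3), (3, 4), (1, 0), (2, 1), (3, 2), (4, 3)}"
  "parcs cycle5 = {(0, 1), (1, 2), (2, 3), (3, 4), (4, 0), (1, 0), (2, 1), (3, 2), (4, 3), (0, 4)}"
  "parcs bull = {(0, 1), (1, 2), (2, 0), (0, 3), (1, 4), (1, 0), (2, 1), (0, 2), (3, 0), (4, 1)}"
  by (auto simp: path5_def cycle5_def bull_def house_def ugraph_def)

lemma sum_LD_number_five_examples: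
  assumes "H \<in> {path5, cycle5, bull, house}"
  shows "pair_graph H" "card (pverts H) = 5" "LD_number H + LD_number (complement H) \<le> 4"
proof -
  \<comment> \<open>The unprimed vertices are two detectors \<open>p\<close>, \<open>q\<close> with
    three separated vertices in \<open>H\<close>; the primed ones do the same in the complement, so
    their adjacencies are stated negated.\<close>
  have H: "LD_number H \<le> 2 \<and> LD_number (complement H) \<le> 2 \<and> pair_graph H \<and> card (pverts H) = 5"
    if "pair_graph H" "pverts H = {0..4}"
      and "x \<in> {0..4}" "y \<in> {0..4}" "z \<in> {0..4}" "p \<in> {0..4}" "q \<in> {0..4}"
      and "(x, p) \<in> parcs H" "(x, q) \<notin> parcs H" "(y, q) \<in> parcs H" "(y, p) \<notin> parcs H"
      "(z, p) \<in> parcs H" "(z, q) \<in> parcs H" "x \<noteq> q" "y \<noteq> p"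
      and "x' \<in> {0..4}" "y' \<in> {0..4}" "z' \<in> {0..4}" "p' \<in> {0..4}" "q' \<in> {0..4}"
      and "(x', p') \<notin> parcs H" "(x', q') \<in> parcs H" "(y', q') \<notin> parcs H" "(y', p') \<in> parcs H"
      "(z', p') \<notin> parcs H" "(z', q') \<notin> parcs H" "x' \<noteq> p'" "y' \<noteq> q'" "z' \<noteq> p'" "z' \<noteq> q'"
      "x' \<noteq> q'" "y' \<noteq> p'"
    for H :: "nat pair_pre_digraph" and x y z p q x' y' z' p' q' :: nat
  proof -
    have "LD_number H + 3 \<le> card (pverts H)"
      by (rule pair_graph.LD_number_two_detectors[of H x p q y z]) (use that in simp_all)
    moreover have "LD_number (complement H) + 3 \<le> card (pverts (complement H))"
      by (rule pair_graph.LD_number_two_detectors[OF pair_graph_complementI, of H x' p' q' y' z'])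
        (use that in \<open>auto simp: parcs_complement\<close>)
    ultimately show ?thesis using that(1,2) by simp
  qed
  have p: "LD_number path5 \<le> 2 \<and> LD_number (complement path5) \<le> 2 \<and> pair_graph path5 \<and> card (pverts path5) = 5"
    by (rule H[of _ 0 4 2 1 3 3 1 2 0 4]) (simp_all add: pair_graph_examples five_vertex_examples)
  have c: "LD_number cycle5 \<le> 2 \<and> LD_number (complement cycle5) \<le> 2 \<and> pair_graph cycle5 \<and> card (pverts cycle5) = 5"
    by (rule H[of _ 4 3 1 0 2 2 4 3 0 1]) (simp_all add: pair_graph_examples five_vertex_examples)
  have b: "LD_number bull \<le> 2 \<and> LD_number (complement bull) \<le> 2 \<and> pair_graph bull \<and> card (pverts bull) = 5"
    by (rule H[of _ 3 4 2 0 1 1 0 2 3 4]) (simp_all add: pair_graph_examples five_vertex_examples)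
  \<comment> \<open>The house needs no witnesses of its own: passing from the path to its complement
    exchanges the two summands.\<close>
  show "pair_graph H" "card (pverts H) = 5" "LD_number H + LD_number (complement H) \<le> 4"
    using assms p c b by (auto simp: house_def complement_complement pair_graph_complementI)
qed

text \<open>Only the pairs \<open>p q\<close>, \<open>x y\<close> and \<open>x z\<close> remain
  undetermined. Of the eight cases, five give the listed graphs, two give complements of stars with
  sum 5, and one has a disconnected complement.\<close>

lemma sum_LD_number_eq_4_imp_aux:
  assumes G: "pair_graph G" and dc: "doubly_connected G"
    and sum: "LD_number G + LD_number (complement G) = 4"
    and V: "pverts G = {p, q, x, y, z}" "distinct [p, q, x, y, z]"
    and adj: "(x, p) \<in> parcs G" "(x, q) \<notin> parcs G" "(y, q) \<in> parcs G" "(y, p) \<notin> parcs G"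
      "(z, p) \<in> parcs G" "(z, q) \<in> parcs G" "(y, z) \<notin> parcs G"
  shows "graph_iso G path5 \<or> graph_iso G cycle5 \<or> graph_iso G bull \<or> graph_iso G house"
proof -
  interpret pair_graph G by fact
  have card: "card (pverts G) = 5" using V by simp
  have sw: "(p, x) \<in> parcs G" "(q, x) \<notin> parcs G" "(q, y) \<in> parcs G" "(p, y) \<notin> parcs G"
    "(p, z) \<in> parcs G" "(q, z) \<in> parcs G" "(z, y) \<notin> parcs G"
    "q \<sim> p \<longleftrightarrow> p \<sim> q" "y \<sim> x \<longleftrightarrow> x \<sim> y" "z \<sim> x \<longleftrightarrow> x \<sim> z"
    using adj adjacent_sym by blast+
  have not_star: "\<not> graph_iso G (complement (double_star 2 1))"
    "\<not> graph_iso G (complement (extended_star 3 2))"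
  proof -
    have G': "pair_graph (complement G)" "card (pverts (complement G)) \<ge> 5"
      using G card by (simp_all add: pair_graph_complementI)
    have *: "\<not> graph_iso (complement G) (double_star 2 1)" "\<not> graph_iso (complement G) (extended_star 3 2)"
    proof -
      show "\<not> graph_iso (complement G) (double_star 2 1)"
      proof
        assume "graph_iso (complement G) (double_star 2 1)"
        then have "\<exists>r s. 1 \<le> r \<and> 1 \<le> s \<and> graph_iso (complement G) (double_star r s)"
          by (intro exI[of _ 2] exI[of _ 1]) simp
        from sum_LD_number_star[OF G' disjI1[OF this]] show False
          using sum card by (simp add: complement_complement[OF G])
      qed
      show "\<not> graph_iso (complement G) (extended_star 3 2)"
      proof
        assume "graph_iso (complement G) (extended_star 3 2)"
        then have "\<exists>r s. 2 \<le> s \<and> s \<le> r - 1 \<and> graph_iso (complement G) (extended_star r s)"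
          by (intro exI[of _ 3] exI[of _ 2]) simp
        from sum_LD_number_star[OF G' disjI2[OF this]] show False
          using sum card by (simp add: complement_complement[OF G])
      qed
    qed
    then show "\<not> graph_iso G (complement (double_star 2 1))"
      "\<not> graph_iso G (complement (extended_star 3 2))"
      using graph_iso_complement_iff[OF G, of "double_star 2 1"]
        graph_iso_complement_iff[OF G, of "extended_star 3 2"]
        pair_graph_examples(4)[of 2 1] pair_graph_examples(5)[of 2 3] by simp_all
  qed
  have P: "pair_graph (complement (double_star 2 1))" "pair_graph (complement (extended_star 3 2))"
    using pair_graph_examples(4)[of 2 1] pair_graph_examples(5)[of 2 3]
    by (simp_all add: pair_graph_complementI)
  have PV: "pverts (complement (double_star 2 1)) = {0..4}" "pverts (complement (extended_star 3 2)) = {0..4}"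
    by (auto simp: double_star_def extended_star_def ugraph_def)
  have ds: "parcs (double_star 2 1) = {(0, 1), (0, 2), (0, 3), (1, 4), (1, 0), (2, 0), (3, 0), (4, 1)}"
    by (auto simp: double_star_def ugraph_def)
  have es: "parcs (extended_star 3 2) = {(0, 1), (0, 2), (0, 3), (4, 1), (4, 2),
      (1, 0), (2, 0), (3, 0), (1, 4), (2, 4)}"
  proof -
    have "{1..3::nat} = {1, 2, 3}" "{1..2::nat} = {1, 2}" "3 + 1 = (4::nat)" by auto
    then show ?thesis unfolding extended_star_def ugraph_def by auto
  qed
  note table = adj sw five_vertex_examples(4-7) house_def parcs_complement five_vertex_examples(1) ds es
    PV[unfolded pverts_complement]
  consider "\<not> p \<sim> q" "\<not> x \<sim> y" "\<not> x \<sim> z" | "\<not> p \<sim> q" "x \<sim> y" "\<not> x \<sim> z"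
    | "\<not> p \<sim> q" "x \<sim> y" "x \<sim> z" | "\<not> p \<sim> q" "\<not> x \<sim> y" "x \<sim> z"
    | "p \<sim> q" "\<not> x \<sim> y" "\<not> x \<sim> z" | "p \<sim> q" "x \<sim> y" "\<not> x \<sim> z"
    | "p \<sim> q" "x \<sim> y" "x \<sim> z" | "p \<sim> q" "\<not> x \<sim> y" "x \<sim> z"
    by (cases "p \<sim> q"; cases "x \<sim> y"; cases "x \<sim> z") simp_all
  then show ?thesis
  proof cases
    case 1
    have "pverts G = {x, p, z, q, y}" "distinct [x, p, z, q, y]" using V by auto
    then have "graph_iso G path5"
      by (rule graph_iso_five[OF G _ _ pair_graph_examples(1) five_vertex_examples(1)]) (simp_all add: 1 table)
    then show ?thesis by simp
  next
    case 2
    have "pverts G = {x, p, z, q, y}" "distinct [x, p, z, q, y]" using V by auto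
    then have "graph_iso G cycle5"
      by (rule graph_iso_five[OF G _ _ pair_graph_examples(2) five_vertex_examples(2)]) (simp_all add: 2 table)
    then show ?thesis by simp
  next
    case 3
    have "pverts G = {x, q, p, y, z}" "distinct [x, q, p, y, z]" using V by auto
    then have "graph_iso G house"
      by (rule graph_iso_five[OF G _ _ pair_graph_house five_vertex_examples(4)]) (simp_all add: 3 table)
    then show ?thesis by simp
  next
    case 4
    have "pverts G = {y, x, p, z, q}" "distinct [y, x, p, z, q]" using V by auto
    then have "graph_iso G (complement (extended_star 3 2))"
      by (rule graph_iso_five[OF G _ _ P(2) PV(2)]) (simp_all add: 4 table)
    then show ?thesis using not_star by simp
  next
    case 5
    have "pverts G = {p, q, z, x, y}" "distinct [p, q, z, x, y]" using V by auto
    then have "graph_iso G bull"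
      by (rule graph_iso_five[OF G _ _ pair_graph_examples(3) five_vertex_examples(3)]) (simp_all add: 5 table)
    then show ?thesis by simp
  next
    case 6
    have "pverts G = {q, x, z, y, p}" "distinct [q, x, z, y, p]" using V by auto
    then have "graph_iso G house"
      by (rule graph_iso_five[OF G _ _ pair_graph_house five_vertex_examples(4)]) (simp_all add: 6 table)
    then show ?thesis by simp
  next
    case 7
    \<comment> \<open>Here \<open>x\<close> and \<open>q\<close> are both joined to all of
      \<open>p\<close>, \<open>y\<close>, \<open>z\<close>, so no edge of the complement leaves
      \<open>{x, q}\<close>.\<close>
    have "{x, q} \<subseteq> pverts G" "{x, q} \<noteq> {}" by (simp_all add: V(1))
    moreover have "p \<in> pverts G" "p \<notin> {x, q}" using V by auto
    then have "{x, q} \<noteq> pverts G" by metis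
    ultimately obtain u w where "u \<in> {x, q}" "w \<in> pverts G - {x, q}" "\<not> u \<sim> w"
      using co_connected_cut[of "{x, q}"] dc by (metis doubly_connected_def)
    moreover from this have "w = p \<or> w = y \<or> w = z" using V(1) by auto
    ultimately have False using 7 adj sw by (elim insertE emptyE disjE) simp_all
    then show ?thesis ..
  next
    case 8
    have "pverts G = {y, x, p, z, q}" "distinct [y, x, p, z, q]" using V by auto
    then have "graph_iso G (complement (double_star 2 1))"
      by (rule graph_iso_five[OF G _ _ P(1) PV(1)]) (simp_all add: 8 table del: One_nat_def)
    then show ?thesis using not_star by simp
  qed
qed

text \<open>Both numbers are at least 2, so some LD-set has two elements. It leaves at most three
  further vertices, so n = 5 and the three nonempty traces each occur exactly once.\<close>

lemma sum_LD_number_eq_4_imp: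
  assumes G: "pair_graph G" and dc: "doubly_connected G" and five: "card (pverts G) \<ge> 5"
    and sum: "LD_number G + LD_number (complement G) = 4"
  shows "graph_iso G path5 \<or> graph_iso G cycle5 \<or> graph_iso G bull \<or> graph_iso G house"
proof -
  interpret pair_graph G by fact
  interpret co: pair_graph "complement G" using G by (rule pair_graph_complementI)
  have "LD_number G = 2" using LD_number_ge_2 co.LD_number_ge_2 five sum by simp
  then obtain D where D: "LD_set G D" "card D = 2" by (metis LD_number_attained)
  have sub: "D \<subseteq> pverts G" "finite D" using D finite_subset[OF _ pair_finite_verts] by (auto simp: LD_set_def)
  have n: "card (pverts G) = 5" using LD_set_card_bound[OF D(1)] D(2) five by simp
  obtain p q where pq: "D = {p, q}" "p \<noteq> q" using D(2) by (auto simp: card_2_iff)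
  let ?S = "pverts G - D" and ?t = "\<lambda>u. nbhd G u \<inter> D"
  have S: "card ?S = 3" using n D sub by (simp add: card_Diff_subset)
  have inj: "inj_on ?t ?S" using D(1) unfolding LD_set_def inj_on_def by blast
  have sub3: "?t ` ?S \<subseteq> {{p}, {q}, {p, q}}"
  proof
    fix T assume "T \<in> ?t ` ?S"
    then have "T \<noteq> {}" "T \<subseteq> D" using LD_set_empty_trace[OF D(1), of "{_}"] by auto
    then show "T \<in> {{p}, {q}, {p, q}}" unfolding pq by blast
  qed
  have "card (?t ` ?S) = card {{p}, {q}, {p, q}}"
    using card_image[OF inj] S pq by (simp add: card_insert_if doubleton_eq_iff)
  with sub3 have im: "?t ` ?S = {{p}, {q}, {p, q}}" by (intro card_subset_eq) auto
  have "{p} \<in> ?t ` ?S" using im by simp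
  then obtain x where x: "x \<in> ?S" "?t x = {p}" by (elim imageE) simp
  have "{q} \<in> ?t ` ?S" using im by simp
  then obtain y where y: "y \<in> ?S" "?t y = {q}" by (elim imageE) simp
  have "{p, q} \<in> ?t ` ?S" using im by simp
  then obtain z where z: "z \<in> ?S" "?t z = {p, q}" by (elim imageE) simp
  have adj: "(x, p) \<in> parcs G" "(x, q) \<notin> parcs G" "(y, q) \<in> parcs G" "(y, p) \<notin> parcs G"
      "(z, p) \<in> parcs G" "(z, q) \<in> parcs G"
    using x(2) y(2) z(2) pq by (auto simp: nbhd_def)
  have dist: "distinct [p, q, x, y, z]" using adj pq x y z by auto
  have V: "{p, q, x, y, z} = pverts G"
  proof (rule card_subset_eq[OF pair_finite_verts])
    show "{p, q, x, y, z} \<subseteq> pverts G" using sub pq x y z by auto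
    show "card {p, q, x, y, z} = card (pverts G)" using dist n by simp
  qed
  \<comment> \<open>Otherwise \<open>z\<close> is adjacent to every other vertex and is isolated in
    the complement. Exchanging \<open>p\<close> with \<open>q\<close> and \<open>x\<close> with
    \<open>y\<close> then allows assuming that \<open>y\<close> and \<open>z\<close> are not
    adjacent.\<close>
  have "\<not> (y \<sim> z \<and> x \<sim> z)"
  proof
    assume yx: "y \<sim> z \<and> x \<sim> z"
    have "{z} \<subseteq> pverts G" "{z} \<noteq> pverts G" using V dist by auto
    then obtain w where "w \<in> pverts G - {z}" "\<not> w \<sim> z"
      using co_connected_cut[of "{z}"] dc adjacent_sym[of z]
      by (metis doubly_connected_def insert_not_empty singletonD)
    then show False using V[symmetric] adj(5,6) yx adjacent_sym[of z] by auto
  qed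
  then consider "\<not> y \<sim> z" | "\<not> x \<sim> z" by blast
  then show ?thesis
  proof cases
    case 1
    from sum_LD_number_eq_4_imp_aux[OF G dc sum V[symmetric] dist] adj 1 show ?thesis by simp
  next
    case 2
    have "pverts G = {q, p, y, x, z}" "distinct [q, p, y, x, z]" using V dist by auto
    from sum_LD_number_eq_4_imp_aux[OF G dc sum this] adj 2 show ?thesis by simp
  qed
qed

lemma sum_LD_number_eq_4_if:
  assumes G: "pair_graph G"
    and iso: "graph_iso G path5 \<or> graph_iso G cycle5 \<or> graph_iso G bull \<or> graph_iso G house"
  shows "LD_number G + LD_number (complement G) \<le> 4"
proof -
  obtain H where H: "H \<in> {path5, cycle5, bull, house}" "graph_iso G H" using iso by blast
  note H' = sum_LD_number_five_examples[OF H(1)]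
  have "LD_number G = LD_number H" "LD_number (complement G) = LD_number (complement H)"
    using G H(2) H'(1) by (auto intro!: LD_number_iso graph_iso_complement pair_graph_complementI)
  then show ?thesis using H'(3) by simp
qed

section \<open>Both bounds and their equality cases\<close>

theorem theorem6:
  fixes G :: "'a pair_pre_digraph" and n :: nat
  assumes "pair_graph G"
    and "doubly_connected G"
    and "card (pverts G) = n"
    and "n \<ge> 5"
  shows "4 \<le> LD_number G + LD_number (complement G) \<and>
    LD_number G + LD_number (complement G) \<le> 2 * n - 5 \<and>
    (LD_number G + LD_number (complement G) = 4 \<longleftrightarrow>
       graph_iso G path5 \<or> graph_iso G cycle5 \<or> graph_iso G bull \<or> graph_iso G house) \<and>
    (LD_number G + LD_number (complement G) = 2 * n - 5 \<longleftrightarrow>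
       (\<exists>r s. 1 \<le> r \<and> 1 \<le> s \<and>
          (graph_iso G (double_star r s) \<or> graph_iso G (complement (double_star r s)))) \<or>
       (\<exists>r s. 2 \<le> s \<and> s \<le> r - 1 \<and>
          (graph_iso G (extended_star r s) \<or> graph_iso G (complement (extended_star r s)))))"
proof -
  interpret pair_graph G by fact
  let ?H = "complement G"
  interpret co: pair_graph ?H using assms(1) by (rule pair_graph_complementI)
  define star where "star K \<longleftrightarrow>
    (\<exists>r s. 1 \<le> r \<and> 1 \<le> s \<and> graph_iso K (double_star r s)) \<or>
    (\<exists>r s. 2 \<le> s \<and> s \<le> r - 1 \<and> graph_iso K (extended_star r s))" for K :: "'a pair_pre_digraph"
  have n: "card (pverts G) = n" "card (pverts ?H) = n" "n \<ge> 5" using assms by simp_all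
  have dc: "doubly_connected G" "doubly_connected ?H"
    using assms by (simp_all add: doubly_connected_complement)
  have HH: "complement ?H = G" using assms(1) by (rule complement_complement)
  have lower: "4 \<le> LD_number G + LD_number ?H"
    using LD_number_ge_2 co.LD_number_ge_2 n by simp
  have "LD_number G + LD_number ?H = 2 * n - 5" if "star G"
    using sum_LD_number_star[OF assms(1) _ that[unfolded star_def]] n by simp
  moreover have "LD_number G + LD_number ?H = 2 * n - 5" if "star ?H"
    using sum_LD_number_star[OF co.pair_graph _ that[unfolded star_def]] n by (simp add: HH)
  ultimately have star_sum: "LD_number G + LD_number ?H = 2 * n - 5" if "star G \<or> star ?H"
    using that by blast
  \<comment> \<open>By the structure result neither number reaches n - 2, so the sum is at most 2n -
    6.\<close>
  have no_star: "LD_number G + LD_number ?H < 2 * n - 5" if "\<not> (star G \<or> star ?H)"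
  proof -
    have "\<not> n < LD_number G + 3"
      using that large_LD_number_imp_star[OF _ dc(1), folded star_def] n by auto
    moreover have "\<not> n < LD_number ?H + 3"
      using that co.large_LD_number_imp_star[OF _ dc(2), folded star_def] n by auto
    ultimately show ?thesis using n(3) by linarith
  qed
  have co_ds: "graph_iso ?H (double_star r s) \<longleftrightarrow> graph_iso G (complement (double_star r s))" for r s
    using assms(1) pair_graph_examples(4) by (rule graph_iso_complement_iff)
  have co_es: "2 \<le> s \<and> s \<le> r - 1 \<and> graph_iso ?H (extended_star r s) \<longleftrightarrow>
      2 \<le> s \<and> s \<le> r - 1 \<and> graph_iso G (complement (extended_star r s))" for r s
  \<comment> \<open>The extended star is known to be a pair graph for \<open>s \<le> r\<close>; for
    larger \<open>s\<close> both sides are false.\<close>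
  proof (cases "s \<le> r")
    case True
    show ?thesis
      using graph_iso_complement_iff[OF assms(1) pair_graph_examples(5)[OF True]] by simp
  qed auto
  have eq_iff: "LD_number G + LD_number ?H = 2 * n - 5 \<longleftrightarrow> star G \<or> star ?H"
  proof
    assume eq: "LD_number G + LD_number ?H = 2 * n - 5"
    show "star G \<or> star ?H"
    proof (rule ccontr)
      assume "\<not> (star G \<or> star ?H)"
      from no_star[OF this] eq show False by simp
    qed
  qed (rule star_sum)
  have "star G \<or> star ?H \<longleftrightarrow>
      (\<exists>r s. 1 \<le> r \<and> 1 \<le> s \<and>
        (graph_iso G (double_star r s) \<or> graph_iso G (complement (double_star r s)))) \<or>
      (\<exists>r s. 2 \<le> s \<and> s \<le> r - 1 \<and>
        (graph_iso G (extended_star r s) \<or> graph_iso G (complement (extended_star r s))))"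
    unfolding star_def co_ds co_es by (simp only: conj_disj_distribL ex_disj_distrib disj_ac)
  note families = eq_iff[unfolded this]
  have "LD_number G + LD_number ?H \<le> 2 * n - 5"
  proof (cases "star G \<or> star ?H")
    case True
    from star_sum[OF this] show ?thesis by simp
  next
    case False
    from no_star[OF this] show ?thesis by simp
  qed
  moreover have "LD_number G + LD_number ?H = 4 \<longleftrightarrow>
      graph_iso G path5 \<or> graph_iso G cycle5 \<or> graph_iso G bull \<or> graph_iso G house"
    using sum_LD_number_eq_4_imp[OF assms(1) dc(1)] sum_LD_number_eq_4_if[OF assms(1)] lower n(1,3)
    by (intro iffI) simp_all
  ultimately show ?thesis using lower families by (intro conjI)
qed

end
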